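(* Let $\Omega := \mathcal{T}(\mathcal{A})$ be compact, let $k \in C^4(\operatorname{conv}(\Omega)\times\operatorname{conv}(\Omega))$ be a strictly positive definite kernel, let the value function $v$ be radially unbounded (that is, $v(x)\to\infty$ as $\|x\|_2\to\infty$) with $v\in\mathcal{H}_k(\Omega)$, and let $f,g\in C^1(\mathcal{T}(\mathcal{A}))$. Then for every $T>0$ there is a constant $C_T>0$, independent of the tolerances $\epsilon_{tol,d},\epsilon_{tol,f}>0$ and of the respective Hermite kernel interpolant $s_v^n$, such that $$\max_{(t,x_0)\in[0,T]\times\mathcal{A}}\Big(\big|v(\mathbf{x}^*(t;x_0))-s_v^n(\mathbf{x}^*(t;x_0))\big|+\big\|\nabla v(\mathbf{x}^*(t;x_0))-\nabla s_v^n(\mathbf{x}^*(t;x_0))\big\|_2\Big)\le \epsilon_{tol,d}\,C_T+\epsilon_{tol,f}$$ whenever the Greedy exploration algorithm with tolerance $\epsilon_{tol,d}$ has terminated with data set $\mathcal{D}$ and the Hermite VKOGA, run on $\mathcal{D}$ with tolerance $\epsilon_{tol,f}$, has terminated with output $s_v^n$.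
   Context: **Optimal control problem.** Let $f:\mathbb{R}^N\to\mathbb{R}^N$, $g:\mathbb{R}^N\to\mathbb{R}^{N\times M}$, $f(0)=0$, let $r\in C(\mathbb{R}^N,\mathbb{R}_+)$ with $r^{-1}(\{0\})=\{0\}$, and let $R\in\mathbb{R}^{M\times M}$ be positive definite. Let $\mathcal{U}_\infty$ be the set of measurable $\mathbf{u}:[0,\infty)\to\mathbb{R}^M$. For an initial state $x$, the problem is to minimize $\int_0^\infty r(\mathbf{x}(s))+\mathbf{u}(s)^\top R\,\mathbf{u}(s)\,ds$ over $\mathbf{u}\in\mathcal{U}_\infty$ subject to $\dot{\mathbf{x}}(s)=f(\mathbf{x}(s))+g(\mathbf{x}(s))\mathbf{u}(s)$, $\mathbf{x}(0)=x$. The value function $v(x)$ is the minimal cost. $\mathcal{A}\subset\mathbb{R}^N$ is a non-empty compact set such that for every $x_0\in\mathcal{A}$ there is an optimal process $(\mathbf{x}^*(\cdot;x_0),\mathbf{u}^*(\cdot;x_0))$. $\mathcal{T}(\mathcal{A})$ is the closure of $\{\mathbf{x}^*(t;x_0): x_0\in\mathcal{A},\ t\in[0,\infty)\}$. Optimal controls are given by the feedback rule $\mathbf{u}^*(s)=-\frac12R^{-1}g(\mathbf{x}^*(s))^\top\nabla v(\mathbf{x}^*(s))$, so optimal trajectories satisfy $\dot{\mathbf{x}}^*=f(\mathbf{x}^* )-\frac12g(\mathbf{x}^* )R^{-1}g(\mathbf{x}^* )^\top\nabla v(\mathbf{x}^* )$. Moreover $v(0)=0$ and $\nabla v(0)=0$.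 **Kernels.** A kernel on a set is a symmetric real-valued function $k$ of two arguments; it is strictly positive definite if all Gram matrices $(k(x_i,x_j))_{i,j}$ for finitely many pairwise distinct points are positive definite. $\mathcal{H}_k(\Omega)$ is the reproducing kernel Hilbert space of $k$ (restricted to $\Omega\times\Omega$). $\operatorname{conv}$ is the convex hull. $\nabla_1$, $\partial_{1,i}$ act on the first argument of $k$. For $h\in\mathcal{H}_k(\Omega)$, $x\in\Omega$: $h(x)=\langle k(x,\cdot),h\rangle_{\mathcal{H}_k(\Omega)}$ and $\partial_i h(x)=\langle\partial_{1,i}k(x,\cdot),h\rangle_{\mathcal{H}_k(\Omega)}$. $C^m$ functions on compact sets are understood to be $C^m$ on a neighbourhood. **Hermite kernel interpolant.** For a finite set $X_n=\{x_1,\dots,x_n\}\subset\Omega$ of pairwise distinct points, $s_v^n(x)=\sum_{i=1}^n\alpha_ik(x_i,x)+\langle\beta_i,\nabla_1k(x_i,x)\rangle$ with $\alpha_i\in\mathbb{R}$, $\beta_i\in\mathbb{R}^N$ such that $s_v^n(x_j)=v(x_j)$ and $\nabla s_v^n(x_j)=\nabla v(x_j)$ for $j=1,\dots,n$. **Greedy exploration algorithm** (tolerance $\epsilon_{tol,d}$). Start with $\mathcal{D}=\{0\}$ and $\epsilon:=\epsilon_{tol,d}+1$. While $\epsilon>\epsilon_{tol,d}$: choose $x_a\in\arg\max_{x\in\mathcal{A}}\min_{y\in\mathcal{D}}\|x-y\|_2$; set $\epsilon:=\min_{y\in\mathcal{D}}\|x_a-y\|_2$; replace $\mathcal{D}$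 by $\mathcal{D}\cup\{\mathbf{x}^*(t;x_a):t\in[0,\infty)\}$. The output is $\mathcal{D}\subset\mathcal{T}(\mathcal{A})$ with the exact values $v(\mathcal{D})$ and $\nabla v(\mathcal{D})$. **Hermite VKOGA** (tolerance $\epsilon_{tol,f}$). Start with $X=\emptyset$, $s_v=0$. While $\max_{x\in\mathcal{D}\setminus X}(|v(x)-s_v(x)|+\|\nabla v(x)-\nabla s_v(x)\|_2)>\epsilon_{tol,f}$: add to $X$ a maximizer over $\mathcal{D}\setminus X$ of $|v(x)-s_v(x)|+\|\nabla v(x)-\nabla s_v(x)\|_2$, and let $s_v$ be the Hermite kernel interpolant of $v$ at the points of $X$. The output is the final $s_v=s_v^n$, $n=|X|$.
   Formalization: If conv(Ω) has empty interior, k is additionally assumed to be a strictly positive definite kernel on some open neighbourhood of conv(Ω); otherwise the normal derivatives of the Hermite interpolant can be arbitrary off the data and the claim fails. *)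

theory Defs
  imports "HOL-Analysis.Analysis"
begin

section \<open>Gradients and functions of class \<open>C\<^sup>m\<close>\<close>

definition grad :: "(real^'n \<Rightarrow> real) \<Rightarrow> real^'n \<Rightarrow> real^'n" where
  "grad h x = (\<chi> i. frechet_derivative h (at x) (axis i 1))"

text \<open>The class \<open>C\<^sup>m\<close> on an open set \<open>S\<close>: all iterated directional derivatives of a
  (Frechet) differentiable function are again of this kind, and those of order \<open>m\<close> are
  continuous.\<close>

fun C_on :: "nat \<Rightarrow> ('a::euclidean_space \<Rightarrow> 'b::euclidean_space) \<Rightarrow> 'a set \<Rightarrow> bool" where
  "C_on 0 h S \<longleftrightarrow> continuous_on S h"
| "C_on (Suc m) h S \<longleftrightarrow>
     (\<forall>x\<in>S. h differentiable (at x)) \<and>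
     (\<forall>d. C_on m (\<lambda>x. frechet_derivative h (at x) d) S)"

definition C_nbhd :: "nat \<Rightarrow> ('a::euclidean_space \<Rightarrow> 'b::euclidean_space) \<Rightarrow> 'a set \<Rightarrow> bool" where
  "C_nbhd m h K \<longleftrightarrow> (\<exists>U. open U \<and> K \<subseteq> U \<and> C_on m h U)"

section \<open>The optimal control problem\<close>

definition pos_def_matrix :: "real^'m^'m \<Rightarrow> bool" where
  "pos_def_matrix R \<longleftrightarrow> transpose R = R \<and> (\<forall>z. z \<noteq> 0 \<longrightarrow> z \<bullet> (R *v z) > 0)"

text \<open>Controls are only measurable, so the state equation is read in the sense of
  Caratheodory: \<open>x\<close> is the integral of the right-hand side.\<close>

definition control_process ::
  "(real^'n \<Rightarrow> real^'n) \<Rightarrow> (real^'n \<Rightarrow> real^'m^'n) \<Rightarrow> real^'n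
     \<Rightarrow> (real \<Rightarrow> real^'n) \<Rightarrow> (real \<Rightarrow> real^'m) \<Rightarrow> bool" where
  "control_process f g x0 x u \<longleftrightarrow>
     u \<in> borel_measurable (lebesgue_on {0..}) \<and>
     (\<forall>t\<ge>0. (\<lambda>s. f (x s) + g (x s) *v u s) absolutely_integrable_on {0..t} \<and>
            x t = x0 + integral {0..t} (\<lambda>s. f (x s) + g (x s) *v u s))"

definition cost ::
  "(real^'n \<Rightarrow> real) \<Rightarrow> real^'m^'m \<Rightarrow> (real \<Rightarrow> real^'n) \<Rightarrow> (real \<Rightarrow> real^'m) \<Rightarrow> ennreal" where
  "cost r R x u = (\<integral>\<^sup>+ s. ennreal (r (x s) + u s \<bullet> (R *v u s)) \<partial>(lebesgue_on {0..}))"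

text \<open>The optimal cost is \<open>\<infinity>\<close> at states from which no process of finite cost starts.
  The real-valued value function is meaningful where the optimal cost is finite.\<close>

definition opt_cost ::
  "(real^'n \<Rightarrow> real^'n) \<Rightarrow> (real^'n \<Rightarrow> real^'m^'n) \<Rightarrow> (real^'n \<Rightarrow> real) \<Rightarrow> real^'m^'m
     \<Rightarrow> real^'n \<Rightarrow> ennreal" where
  "opt_cost f g r R x0 = (INF (x, u) \<in> {(x, u). control_process f g x0 x u}. cost r R x u)"

definition value_fn ::
  "(real^'n \<Rightarrow> real^'n) \<Rightarrow> (real^'n \<Rightarrow> real^'m^'n) \<Rightarrow> (real^'n \<Rightarrow> real) \<Rightarrow> real^'m^'m
     \<Rightarrow> real^'n \<Rightarrow> real" where
  "value_fn f g r R x0 = enn2real (opt_cost f g r R x0)"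

definition optimal_process ::
  "(real^'n \<Rightarrow> real^'n) \<Rightarrow> (real^'n \<Rightarrow> real^'m^'n) \<Rightarrow> (real^'n \<Rightarrow> real) \<Rightarrow> real^'m^'m
     \<Rightarrow> real^'n \<Rightarrow> (real \<Rightarrow> real^'n) \<Rightarrow> (real \<Rightarrow> real^'m) \<Rightarrow> bool" where
  "optimal_process f g r R x0 x u \<longleftrightarrow>
     control_process f g x0 x u \<and> cost r R x u = opt_cost f g r R x0"

definition traj :: "('s \<Rightarrow> real \<Rightarrow> 's) \<Rightarrow> 's \<Rightarrow> 's set" where
  "traj xs x0 = xs x0 ` {0..}"

definition traj_closure :: "(real^'n) set \<Rightarrow> (real^'n \<Rightarrow> real \<Rightarrow> real^'n) \<Rightarrow> (real^'n) set" where
  "traj_closure A xs = closure (\<Union>x0\<in>A. traj xs x0)"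

section \<open>Kernels and reproducing kernel Hilbert spaces\<close>

definition spd_kernel_on :: "'a set \<Rightarrow> ('a \<Rightarrow> 'a \<Rightarrow> real) \<Rightarrow> bool" where
  "spd_kernel_on S k \<longleftrightarrow>
     (\<forall>x\<in>S. \<forall>y\<in>S. k x y = k y x) \<and>
     (\<forall>X c. finite X \<and> X \<subseteq> S \<and> (\<exists>x\<in>X. c x \<noteq> 0) \<longrightarrow>
        (\<Sum>x\<in>X. \<Sum>y\<in>X. c x * c y * k x y) > (0::real))"

text \<open>A function on \<open>S\<close> is represented by its extension by \<open>0\<close>.\<close>

definition on_set :: "'a set \<Rightarrow> ('a \<Rightarrow> real) \<Rightarrow> 'a \<Rightarrow> real" where
  "on_set S h = (\<lambda>x. if x \<in> S then h x else 0)"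

text \<open>\<open>(H, ip)\<close> is a Hilbert space of functions on \<open>S\<close> with reproducing kernel \<open>k\<close>. By the
  Moore-Aronszajn theorem there is exactly one such \<open>H\<close>, with \<open>ip\<close> unique on \<open>H\<close>.\<close>

definition is_rkhs ::
  "('a \<Rightarrow> 'a \<Rightarrow> real) \<Rightarrow> 'a set \<Rightarrow> ('a \<Rightarrow> real) set
     \<Rightarrow> (('a \<Rightarrow> real) \<Rightarrow> ('a \<Rightarrow> real) \<Rightarrow> real) \<Rightarrow> bool" where
  "is_rkhs k S H ip \<longleftrightarrow>
     (\<forall>h\<in>H. on_set S h = h) \<and>
     (\<lambda>x. 0) \<in> H \<and>
     (\<forall>h\<in>H. \<forall>l\<in>H. (\<lambda>x. h x + l x) \<in> H) \<and>
     (\<forall>h\<in>H. \<forall>c. (\<lambda>x. c * h x) \<in> H) \<and>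
     (\<forall>h\<in>H. \<forall>l\<in>H. ip h l = ip l h) \<and>
     (\<forall>h\<in>H. \<forall>l\<in>H. \<forall>w\<in>H. ip (\<lambda>x. h x + l x) w = ip h w + ip l w) \<and>
     (\<forall>h\<in>H. \<forall>w\<in>H. \<forall>c. ip (\<lambda>x. c * h x) w = c * ip h w) \<and>
     (\<forall>h\<in>H. ip h h \<ge> 0 \<and> (ip h h = 0 \<longrightarrow> h = (\<lambda>x. 0))) \<and>
     (\<forall>F. (\<forall>n. F n \<in> H) \<and>
          (\<forall>e>0. \<exists>n0::nat. \<forall>m\<ge>n0. \<forall>n\<ge>n0.
             ip (\<lambda>x. F m x - F n x) (\<lambda>x. F m x - F n x) < e) \<longrightarrow>
          (\<exists>h\<in>H. (\<lambda>n. ip (\<lambda>x. F n x - h x) (\<lambda>x. F n x - h x)) \<longlonglongrightarrow> 0)) \<and>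
     (\<forall>x\<in>S. on_set S (k x) \<in> H \<and> (\<forall>h\<in>H. h x = ip (on_set S (k x)) h))"

definition grad1 :: "(real^'n \<Rightarrow> real^'n \<Rightarrow> real) \<Rightarrow> real^'n \<Rightarrow> real^'n \<Rightarrow> real^'n" where
  "grad1 k x y = grad (\<lambda>z. k z y) x"

text \<open>The derivative reproducing property of a member \<open>h\<close> of the reproducing kernel Hilbert
  space on \<open>S\<close>. The left-hand side is the gradient of the function \<open>h\<close> on the ambient space,
  which its values on \<open>S\<close> need not determine when \<open>S\<close> is thin.\<close>

definition derivative_reproducing ::
  "(real^'n \<Rightarrow> real^'n \<Rightarrow> real) \<Rightarrow> (real^'n) set \<Rightarrow> (real^'n \<Rightarrow> real) set
     \<Rightarrow> ((real^'n \<Rightarrow> real) \<Rightarrow> (real^'n \<Rightarrow> real) \<Rightarrow> real) \<Rightarrow> (real^'n \<Rightarrow> real) \<Rightarrow> bool" where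
  "derivative_reproducing k S H ip h \<longleftrightarrow>
     (\<forall>x\<in>S. \<forall>i. on_set S (\<lambda>y. grad1 k x y $ i) \<in> H \<and>
        grad h x $ i = ip (on_set S (\<lambda>y. grad1 k x y $ i)) (on_set S h))"

section \<open>Hermite interpolation and the two greedy algorithms\<close>

definition hermite_interpolant ::
  "(real^'n \<Rightarrow> real^'n \<Rightarrow> real) \<Rightarrow> (real^'n \<Rightarrow> real) \<Rightarrow> (real^'n) set \<Rightarrow> (real^'n \<Rightarrow> real) \<Rightarrow> bool" where
  "hermite_interpolant k v X s \<longleftrightarrow>
     finite X \<and>
     (\<exists>\<alpha> \<beta>. s = (\<lambda>x. \<Sum>y\<in>X. \<alpha> y * k y x + \<beta> y \<bullet> grad1 k y x)) \<and>
     (\<forall>y\<in>X. s y = v y \<and> grad s y = grad v y)"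

definition hermite_error :: "(real^'n \<Rightarrow> real) \<Rightarrow> (real^'n \<Rightarrow> real) \<Rightarrow> real^'n \<Rightarrow> real" where
  "hermite_error v s x = \<bar>v x - s x\<bar> + norm (grad v x - grad s x)"

text \<open>The reachable states \<open>(\<D>, \<epsilon>)\<close> of the exploration loop. Ties are resolved
  arbitrarily, so the loop is a relation. The minimum of the distances to \<open>\<D>\<close> is written as
  the library's \<open>infdist\<close>, which is that minimum whenever it is attained.\<close>

inductive exploration_state ::
  "(real^'n) set \<Rightarrow> (real^'n \<Rightarrow> real \<Rightarrow> real^'n) \<Rightarrow> real \<Rightarrow> (real^'n) set \<Rightarrow> real \<Rightarrow> bool"
  for A xs tol where
  init: "exploration_state A xs tol {0} (tol + 1)"
| step: "\<lbrakk>exploration_state A xs tol D eps; eps > tol;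
          xa \<in> A; \<forall>x\<in>A. infdist x D \<le> infdist xa D\<rbrakk>
         \<Longrightarrow> exploration_state A xs tol (D \<union> traj xs xa) (infdist xa D)"

definition exploration_output ::
  "(real^'n) set \<Rightarrow> (real^'n \<Rightarrow> real \<Rightarrow> real^'n) \<Rightarrow> real \<Rightarrow> (real^'n) set \<Rightarrow> bool" where
  "exploration_output A xs tol D \<longleftrightarrow> (\<exists>eps. exploration_state A xs tol D eps \<and> eps \<le> tol)"

inductive vkoga_state ::
  "(real^'n \<Rightarrow> real^'n \<Rightarrow> real) \<Rightarrow> (real^'n \<Rightarrow> real) \<Rightarrow> (real^'n) set \<Rightarrow> real
     \<Rightarrow> (real^'n) set \<Rightarrow> (real^'n \<Rightarrow> real) \<Rightarrow> bool"
  for k v D tol where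
  init: "vkoga_state k v D tol {} (\<lambda>x. 0)"
| step: "\<lbrakk>vkoga_state k v D tol X s; y \<in> D - X;
          \<forall>x\<in>D - X. hermite_error v s x \<le> hermite_error v s y;
          hermite_error v s y > tol;
          hermite_interpolant k v (insert y X) s'\<rbrakk>
         \<Longrightarrow> vkoga_state k v D tol (insert y X) s'"

definition vkoga_output ::
  "(real^'n \<Rightarrow> real^'n \<Rightarrow> real) \<Rightarrow> (real^'n \<Rightarrow> real) \<Rightarrow> (real^'n) set \<Rightarrow> real
     \<Rightarrow> (real^'n \<Rightarrow> real) \<Rightarrow> bool" where
  "vkoga_output k v D tol s \<longleftrightarrow>
     (\<exists>X. vkoga_state k v D tol X s \<and> (\<forall>x\<in>D - X. hermite_error v s x \<le> tol))"

end

theory Submission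
  imports Defs
begin

text \<open>The set \<open>\<Omega>\<close> may be thin. Then derivatives cannot be recovered from
  values on it, and \<open>H\<close> does not determine the form on values and partials. That form
  is therefore kept as an object of its own, \<open>jet_kernel\<close>; a combination of its
  sections, read as an element of \<open>H\<close>, can only lose norm, which is the direction
  needed to bound the functional of \<open>v\<close>. The second obstacle is the boundary of the
  convex hull: semidefiniteness of the form is a limit of difference stencils, and a stencil at a
  boundary point leaves the hull. Base points are therefore moved inwards, or, if the hull is flat,
  a neighbourhood from \<open>k_spd_flat\<close> is used. Uniformity in the interpolant holds
  because its squared norm is the functional of \<open>v\<close> applied to its own coefficients,
  hence at most that of \<open>v\<close>. Of the four derivatives of \<open>k\<close>, one per
  argument forms the mixed partials and two are left for the second difference. The exploration data
  need not be closed, so the nearest data point may not exist; this costs the factor 2 in the final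
  constant.\<close>

text \<open>Values and partial derivatives of \<open>v\<close> are functionals whose Gram kernel is formed by \<open>k\<close> and its
  mixed derivatives. The functional of \<open>v\<close> is bounded by the norm of \<open>v\<close> with respect to this form,
  hence so is the functional of each Hermite interpolant, and \<open>k \<in> C\<^sup>4\<close> makes the form of a difference
  of two such functionals \<open>O(\<parallel>x - y\<parallel>\<^sup>2)\<close>. So the interpolation errors of \<open>v\<close> and \<open>\<nabla>v\<close> are Lipschitz
  on \<open>\<Omega>\<close>, uniformly in the interpolant; with the interpolant \<open>0\<close> this covers \<open>\<nabla>v\<close> itself.
  Therefore the closed-loop field is Lipschitz, and by Gronwall a trajectory from \<open>x0\<close> stays
  \<open>O(\<epsilon>d)\<close>-close on \<open>[0, T]\<close> to one in the data set \<open>\<D>\<close>, along which the error is at most \<open>\<epsilon>f\<close>.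
  The data point \<open>0\<close> is an equilibrium in \<open>\<Omega>\<close>, because a trajectory of finite cost cannot stay
  away from the zero of \<open>r\<close>.\<close>

section \<open>Difference quotients and Lipschitz bounds for \<open>C\<^sup>m\<close> functions\<close>

abbreviation dird :: "('a::euclidean_space \<Rightarrow> 'b::euclidean_space) \<Rightarrow> 'a \<Rightarrow> 'a \<Rightarrow> 'b" where
  "dird h d \<equiv> (\<lambda>x. frechet_derivative h (at x) d)"

lemma C_on_SucD: "C_on (Suc m) h S \<Longrightarrow> C_on m h S"
proof (induction m arbitrary: h)
  case 0
  then show ?case
    by (auto intro!: continuous_at_imp_continuous_on differentiable_imp_continuous_within)
next
  case (Suc m)
  then show ?case by (metis C_on.simps(2))
qed

lemma C_on_mono: "m \<le> n \<Longrightarrow> C_on n h S \<Longrightarrow> C_on m h S"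
  by (induction n rule: dec_induct) (use C_on_SucD in blast)+

lemma C_on_continuous: "C_on m h S \<Longrightarrow> continuous_on S h"
  using C_on_mono[of 0 m h S] by simp

lemma has_derivative_frechet:
  "h differentiable (at x) \<Longrightarrow> (h has_derivative frechet_derivative h (at x)) (at x)"
  using frechet_derivative_works by blast

text \<open>\<open>C_on\<close> gives continuity of each directional derivative, not of the
  derivative as an operator. The operator norm is controlled by the sum over the basis, each term
  being bounded on the compact set; convexity then allows the mean value inequality.\<close>

lemma C_on_1_lipschitz_on_convex:
  fixes h :: "'a::euclidean_space \<Rightarrow> 'b::euclidean_space"
  assumes C: "C_on 1 h U" and K: "compact K" "convex K" "K \<subseteq> U"
  obtains L where "L-lipschitz_on K h"
proof -
  have "\<exists>M. \<forall>x\<in>K. norm (dird h b x) \<le> M" for b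
  proof -
    have "continuous_on K (dird h b)"
      using C K(3) by (auto intro: continuous_on_subset[of U])
    then have "bounded (dird h b ` K)"
      using K(1) compact_continuous_image compact_imp_bounded by blast
    then show ?thesis by (auto simp: bounded_iff)
  qed
  then obtain M where M: "\<And>b x. x \<in> K \<Longrightarrow> norm (dird h b x) \<le> M b" by metis
  define B where "B = (\<Sum>b\<in>Basis. \<bar>M b\<bar>)"
  have diff: "h differentiable (at x)" if "x \<in> K" for x using C K(3) that by auto
  have "norm (h x - h y) \<le> B * norm (x - y)" if "x \<in> K" "y \<in> K" for x y
  proof (rule differentiable_bound[where S=K and f'="\<lambda>x. frechet_derivative h (at x)"])
    fix z assume z: "z \<in> K"
    then show "(h has_derivative frechet_derivative h (at z)) (at z within K)"
      using diff has_derivative_frechet has_derivative_at_withinI by blast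
    have "bounded_linear (frechet_derivative h (at z))"
      using diff[OF z] has_derivative_frechet has_derivative_bounded_linear by blast
    then have "onorm (frechet_derivative h (at z)) \<le> (\<Sum>b\<in>Basis. norm (dird h b z))"
      by (rule onorm_componentwise)
    also have "\<dots> \<le> B" unfolding B_def using M[OF z]
      by (intro sum_mono) (meson abs_ge_self order_trans)
    finally show "onorm (frechet_derivative h (at z)) \<le> B" .
  qed (use K that in auto)
  moreover have "B \<ge> 0" by (auto simp: B_def intro: sum_nonneg)
  ultimately have "B-lipschitz_on K h" by (auto simp: lipschitz_on_def dist_norm)
  then show ?thesis by (rule that)
qed

text \<open>Serves \<open>f\<close> and \<open>g\<close>, which are smooth only near
  \<open>\<Omega>\<close>: segments between points of \<open>K\<close> may leave \<open>U\<close>.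
  The convex case is used on small balls, and compactness makes the local constants global. The
  library notion has a time parameter, here a dummy restricted to one instant.\<close>

lemma C_on_1_lipschitz_on_compact:
  fixes h :: "'a::euclidean_space \<Rightarrow> 'b::euclidean_space"
  assumes C: "C_on 1 h U" and U: "open U" and K: "compact K" "K \<subseteq> U"
  obtains L where "L-lipschitz_on K h"
proof -
  have loc: "local_lipschitz (UNIV::real set) K (\<lambda>_. h)"
  proof (rule local_lipschitzI)
    fix x assume "x \<in> K"
    then obtain e where e: "e > 0" "cball x e \<subseteq> U" using U K open_contains_cball by blast
    obtain L where L: "L-lipschitz_on (cball x e) h"
      using C_on_1_lipschitz_on_convex[OF C, of "cball x e"] e by auto
    show "\<exists>u>0. \<exists>L. \<forall>t\<in>cball t u \<inter> UNIV. L-lipschitz_on (cball x u \<inter> K) h" for t :: real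
      using e L by (intro exI[of _ e]) (auto intro: lipschitz_on_subset)
  qed
  have "local_lipschitz {0::real} K (\<lambda>_. h)"
    using loc by (rule local_lipschitz_subset) auto
  from local_lipschitz_compact_implies_lipschitz[OF this K(1)] obtain L
    where "\<And>t. t \<in> {0::real} \<Longrightarrow> L-lipschitz_on K h" by auto
  then show ?thesis using that by auto
qed

lemma has_derivative_fst_slice:
  assumes "h differentiable (at (x, y))"
  shows "((\<lambda>x. h (x, y)) has_derivative (\<lambda>d. frechet_derivative h (at (x, y)) (d, 0))) (at x)"
proof -
  have "((\<lambda>x. (x, y)) has_derivative (\<lambda>d. (d, 0))) (at x)"
    by (auto intro!: derivative_eq_intros)
  from has_derivative_compose[OF this] show ?thesis
    using has_derivative_frechet[OF assms] by auto
qed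

lemma has_derivative_snd_slice:
  assumes "h differentiable (at (x, y))"
  shows "((\<lambda>y. h (x, y)) has_derivative (\<lambda>d. frechet_derivative h (at (x, y)) (0, d))) (at y)"
proof -
  have "((\<lambda>y. (x, y)) has_derivative (\<lambda>d. (0, d))) (at y)"
    by (auto intro!: derivative_eq_intros)
  from has_derivative_compose[OF this] show ?thesis
    using has_derivative_frechet[OF assms] by auto
qed

text \<open>The left side is \<open>?u x - ?u y\<close> for the increment \<open>?u p\<close> of
  \<open>\<Phi>\<close> in its second argument. The derivative of \<open>?u\<close> is a difference
  of first partials, which are Lipschitz, and so is of order \<open>norm (x - y)\<close>; the mean
  value inequality supplies the other factor.\<close>

lemma C_on_2_second_difference_bound:
  fixes \<Phi> :: "'a::euclidean_space \<times> 'a \<Rightarrow> real"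
  assumes C: "C_on 2 \<Phi> V" and K: "compact K" "convex K" "K \<times> K \<subseteq> V"
  obtains L where "L \<ge> 0"
    "\<And>x y. x \<in> K \<Longrightarrow> y \<in> K \<Longrightarrow> \<Phi> (x, x) - \<Phi> (x, y) - \<Phi> (y, x) + \<Phi> (y, y) \<le> L * (norm (x - y))\<^sup>2"
proof -
  have "\<exists>L. L-lipschitz_on (K \<times> K) (dird \<Phi> (b, 0))" for b :: 'a
  proof -
    have "C_on 1 (dird \<Phi> (b, 0)) V" using C by (simp add: numeral_2_eq_2)
    then obtain L where "L-lipschitz_on (K \<times> K) (dird \<Phi> (b, 0))"
      using C_on_1_lipschitz_on_convex[of "dird \<Phi> (b, 0)" V "K \<times> K"] K
        compact_Times[OF K(1) K(1)] convex_Times[OF K(2) K(2)] by metis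
    then show ?thesis ..
  qed
  then obtain l where l: "\<And>b :: 'a. (l b)-lipschitz_on (K \<times> K) (dird \<Phi> (b, 0))" by metis
  define L where "L = (\<Sum>b\<in>(Basis :: 'a set). l b)"
  have L0: "L \<ge> 0" unfolding L_def by (intro sum_nonneg) (use l lipschitz_on_nonneg in blast)
  have diff: "\<Phi> differentiable (at (x, y))" if "x \<in> K" "y \<in> K" for x y
    using C K(3) that by (auto simp: numeral_2_eq_2)
  have "\<Phi> (x, x) - \<Phi> (x, y) - \<Phi> (y, x) + \<Phi> (y, y) \<le> L * (norm (x - y))\<^sup>2"
    if x: "x \<in> K" and y: "y \<in> K" for x y
  proof -
    let ?u = "\<lambda>p. \<Phi> (p, x) - \<Phi> (p, y)"
    let ?u' = "\<lambda>p d. dird \<Phi> (d, 0) (p, x) - dird \<Phi> (d, 0) (p, y)"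
    have "norm (?u x - ?u y) \<le> L * norm (x - y) * norm (x - y)"
    proof (rule differentiable_bound[where S=K and f'="?u'"])
      fix p assume p: "p \<in> K"
      have d: "(?u has_derivative ?u' p) (at p)"
        using p x y diff by (intro has_derivative_diff has_derivative_fst_slice) auto
      then show "(?u has_derivative ?u' p) (at p within K)"
        by (rule has_derivative_at_withinI)
      have "onorm (?u' p) \<le> (\<Sum>b\<in>Basis. norm (?u' p b))"
        using d has_derivative_bounded_linear onorm_componentwise by blast
      also have "\<dots> \<le> (\<Sum>b\<in>Basis. l b * norm (x - y))"
      proof (rule sum_mono)
        fix b
        have "dist (dird \<Phi> (b, 0) (p, x)) (dird \<Phi> (b, 0) (p, y)) \<le> l b * dist (p, x) (p, y)"
          using l p x y by (intro lipschitz_onD) auto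
        then show "norm (?u' p b) \<le> l b * norm (x - y)"
          by (simp add: dist_norm dist_Pair_Pair)
      qed
      also have "\<dots> = L * norm (x - y)" by (simp add: L_def sum_distrib_right)
      finally show "onorm (?u' p) \<le> L * norm (x - y)" .
    qed (use K x y in auto)
    then show ?thesis by (simp add: power2_eq_square mult.assoc)
  qed
  with L0 show ?thesis by (rule that)
qed

section \<open>Difference quotients at moving base points\<close>

lemma directional_mvt:
  fixes h :: "'a::euclidean_space \<Rightarrow> real"
  assumes "\<And>s. 0 \<le> s \<Longrightarrow> s \<le> t \<Longrightarrow> h differentiable (at (p + s *\<^sub>R d))" "0 < t"
  shows "\<exists>s. 0 < s \<and> s < t \<and> h (p + t *\<^sub>R d) - h p = t * dird h d (p + s *\<^sub>R d)"
proof -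
  have "((\<lambda>s. h (p + s *\<^sub>R d)) has_field_derivative dird h d (p + s *\<^sub>R d)) (at s)"
    if "0 \<le> s" "s \<le> t" for s
  proof -
    have "((\<lambda>s. p + s *\<^sub>R d) has_derivative (\<lambda>r. r *\<^sub>R d)) (at s)"
      by (auto intro!: derivative_eq_intros)
    from has_derivative_compose[OF this has_derivative_frechet[OF assms(1)[OF that]]]
    show ?thesis
      using linear_cmul[OF linear_frechet_derivative[OF assms(1)[OF that]]]
      by (simp add: has_field_derivative_def mult_commute_abs)
  qed
  from MVT2[OF assms(2) this] show ?thesis by auto
qed

text \<open>Differentiability at \<open>p\<close> does not suffice, because the base points
  \<open>P n\<close> move with the step. The mean value theorem turns the quotient into a
  directional derivative at a point tending to \<open>p\<close>, where that derivative is
  continuous.\<close>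

lemma difference_quotient_tendsto:
  fixes h :: "'a::euclidean_space \<Rightarrow> real"
  assumes C: "C_on 1 h V" and V: "open V" "p \<in> V"
    and P: "P \<longlonglongrightarrow> p" and t: "t \<longlonglongrightarrow> 0" "\<And>n. t n > 0"
  shows "(\<lambda>n. (h (P n + t n *\<^sub>R d) - h (P n)) / t n) \<longlonglongrightarrow> dird h d p"
proof (rule tendstoI)
  fix e :: real assume e: "e > 0"
  have "isCont (dird h d) p" using C V by (auto simp: continuous_on_eq_continuous_at)
  then obtain r1 where r1: "r1 > 0" "\<And>x. dist x p < r1 \<Longrightarrow> dist (dird h d x) (dird h d p) < e"
    using e unfolding continuous_at_eps_delta by blast
  obtain r2 where r2: "r2 > 0" "ball p r2 \<subseteq> V" using V open_contains_ball by blast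
  define r where "r = min r1 r2"
  have r: "r > 0" using r1 r2 by (simp add: r_def)
  have "(\<lambda>n. dist (P n) p + t n * norm d) \<longlonglongrightarrow> 0 + 0 * norm d"
    by (intro tendsto_add tendsto_mult tendsto_const t(1) P[THEN tendsto_dist_iff[THEN iffD1]])
  then have "\<forall>\<^sub>F n in sequentially. dist (P n) p + t n * norm d < r"
    using r by (intro order_tendstoD(2)) auto
  then show "\<forall>\<^sub>F n in sequentially. dist ((h (P n + t n *\<^sub>R d) - h (P n)) / t n) (dird h d p) < e"
  proof eventually_elim
    case (elim n)
    have near: "dist (P n + s *\<^sub>R d) p < r" if "0 \<le> s" "s \<le> t n" for s
    proof -
      have "dist (P n + s *\<^sub>R d) p \<le> dist (P n) p + s * norm d"
        using norm_triangle_ineq[of "P n - p" "s *\<^sub>R d"] that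
        by (simp add: dist_norm algebra_simps)
      also have "s * norm d \<le> t n * norm d" using that by (intro mult_right_mono) auto
      finally show ?thesis using elim by linarith
    qed
    have "h differentiable (at (P n + s *\<^sub>R d))" if "0 \<le> s" "s \<le> t n" for s
    proof -
      have "P n + s *\<^sub>R d \<in> V" using near[OF that] r2 by (auto simp: r_def dist_commute)
      then show ?thesis using C by auto
    qed
    from directional_mvt[OF this t(2)] obtain s where s: "0 < s" "s < t n"
      "h (P n + t n *\<^sub>R d) - h (P n) = t n * dird h d (P n + s *\<^sub>R d)" by auto
    then show ?case using r1(2)[of "P n + s *\<^sub>R d"] near[of s] t(2)[of n] by (simp add: r_def)
  qed
qed

text \<open>The mean value theorem is applied twice: along \<open>d\<close> to the increment
  \<open>?H\<close> in direction \<open>e\<close>, which leaves an increment of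
  \<open>dird h d\<close>, and then along \<open>e\<close> to that. The resulting point tends to
  \<open>p\<close>, and the second derivative is continuous there.\<close>

lemma mixed_difference_quotient_tendsto:
  fixes h :: "'a::euclidean_space \<Rightarrow> real"
  assumes C: "C_on 2 h V" and V: "open V" "p \<in> V"
    and P: "P \<longlonglongrightarrow> p" and t: "t \<longlonglongrightarrow> 0" "\<And>n. t n > 0"
  shows "(\<lambda>n. ((h (P n + t n *\<^sub>R d + t n *\<^sub>R e) - h (P n + t n *\<^sub>R d)) - (h (P n + t n *\<^sub>R e) - h (P n)))
            / (t n * t n)) \<longlonglongrightarrow> dird (dird h d) e p"
proof (rule tendstoI)
  fix \<epsilon> :: real assume \<epsilon>: "\<epsilon> > 0"
  let ?g = "dird (dird h d) e"
  have "isCont ?g p" using C V by (auto simp: continuous_on_eq_continuous_at numeral_2_eq_2)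
  then obtain r1 where r1: "r1 > 0" "\<And>x. dist x p < r1 \<Longrightarrow> dist (?g x) (?g p) < \<epsilon>"
    using \<epsilon> unfolding continuous_at_eps_delta by blast
  obtain r2 where r2: "r2 > 0" "ball p r2 \<subseteq> V" using V open_contains_ball by blast
  define r where "r = min r1 r2"
  have r: "r > 0" using r1 r2 by (simp add: r_def)
  have "(\<lambda>n. dist (P n) p + t n * (norm d + norm e)) \<longlonglongrightarrow> 0 + 0 * (norm d + norm e)"
    by (intro tendsto_add tendsto_mult tendsto_const t(1) P[THEN tendsto_dist_iff[THEN iffD1]])
  then have "\<forall>\<^sub>F n in sequentially. dist (P n) p + t n * (norm d + norm e) < r"
    using r by (intro order_tendstoD(2)) auto
  then show "\<forall>\<^sub>F n in sequentially. dist (((h (P n + t n *\<^sub>R d + t n *\<^sub>R e) - h (P n + t n *\<^sub>R d))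
      - (h (P n + t n *\<^sub>R e) - h (P n))) / (t n * t n)) (?g p) < \<epsilon>"
  proof eventually_elim
    case (elim n)
    have near: "dist (P n + s *\<^sub>R d + s' *\<^sub>R e) p < r"
      if "0 \<le> s" "s \<le> t n" "0 \<le> s'" "s' \<le> t n" for s s'
    proof -
      have "dist (P n + s *\<^sub>R d + s' *\<^sub>R e) p \<le> norm (P n - p) + norm (s *\<^sub>R d) + norm (s' *\<^sub>R e)"
        using norm_triangle_ineq[of "P n - p + s *\<^sub>R d" "s' *\<^sub>R e"]
          norm_triangle_ineq[of "P n - p" "s *\<^sub>R d"]
        by (simp add: dist_norm algebra_simps)
      also have "\<dots> = dist (P n) p + (s * norm d + s' * norm e)"
        using that by (simp add: dist_norm)
      also have "s * norm d + s' * norm e \<le> t n * norm d + t n * norm e"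
        using that by (intro add_mono mult_right_mono) auto
      finally show ?thesis using elim by (simp add: algebra_simps)
    qed
    have inV: "P n + s *\<^sub>R d + s' *\<^sub>R e \<in> V"
      if "0 \<le> s" "s \<le> t n" "0 \<le> s'" "s' \<le> t n" for s s'
      using near[OF that] r2 by (auto simp: r_def dist_commute)
    have hd: "h differentiable (at x)" if "x \<in> V" for x using C that by (auto simp: numeral_2_eq_2)
    have dd: "dird h d differentiable (at x)" if "x \<in> V" for x
      using C that by (auto simp: numeral_2_eq_2)
    let ?H = "\<lambda>x. h (x + t n *\<^sub>R e) - h x"
    have hH: "(?H has_derivative (\<lambda>k. frechet_derivative h (at (x + t n *\<^sub>R e)) k
          - frechet_derivative h (at x) k)) (at x)"
      if "x + t n *\<^sub>R e \<in> V" "x \<in> V" for x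
    proof (intro has_derivative_diff has_derivative_frechet hd that)
      have "((\<lambda>x. x + t n *\<^sub>R e) has_derivative (\<lambda>k. k)) (at x)"
        by (auto intro!: derivative_eq_intros)
      from has_derivative_compose[OF this has_derivative_frechet[OF hd[OF that(1)]]]
      show "((\<lambda>x. h (x + t n *\<^sub>R e)) has_derivative frechet_derivative h (at (x + t n *\<^sub>R e))) (at x)"
        by simp
    qed
    have tn: "0 \<le> t n" using t(2)[of n] by simp
    have m1: "P n + s *\<^sub>R d + t n *\<^sub>R e \<in> V" "P n + s *\<^sub>R d \<in> V" if "0 \<le> s" "s \<le> t n" for s
      using inV[of s "t n"] inV[of s 0] that tn by auto
    have "?H differentiable (at (P n + s *\<^sub>R d))" if "0 \<le> s" "s \<le> t n" for s
      using hH[OF m1[OF that]] by (auto simp: differentiable_def)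
    from directional_mvt[OF this t(2)] obtain s where s: "0 < s" "s < t n"
      "?H (P n + t n *\<^sub>R d) - ?H (P n) = t n * dird ?H d (P n + s *\<^sub>R d)" by auto
    have s2: "0 \<le> s" "s \<le> t n" using s by auto
    have "dird ?H d (P n + s *\<^sub>R d) = dird h d (P n + s *\<^sub>R d + t n *\<^sub>R e) - dird h d (P n + s *\<^sub>R d)"
      by (simp only: frechet_derivative_at[OF hH[OF m1[OF s2]], symmetric])
    moreover have "dird h d differentiable (at (P n + s *\<^sub>R d + s' *\<^sub>R e))"
      if "0 \<le> s'" "s' \<le> t n" for s'
      using that s by (intro dd inV) auto
    from directional_mvt[OF this t(2)] obtain s' where s': "0 < s'" "s' < t n"
      "dird h d (P n + s *\<^sub>R d + t n *\<^sub>R e) - dird h d (P n + s *\<^sub>R d)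
        = t n * ?g (P n + s *\<^sub>R d + s' *\<^sub>R e)" by auto
    ultimately have "?H (P n + t n *\<^sub>R d) - ?H (P n) = t n * (t n * ?g (P n + s *\<^sub>R d + s' *\<^sub>R e))"
      using s by simp
    then show ?case using r1(2)[of "P n + s *\<^sub>R d + s' *\<^sub>R e"] near[of s s'] s s' t(2)[of n]
      by (simp add: r_def)
  qed
qed

section \<open>Positive semidefinite forms and reproducing kernel Hilbert spaces\<close>

text \<open>Semidefinite rather than definite, since this is what passes to pointwise limits. The
  index set consists of functionals and not only of points.\<close>

definition psd_on :: "'i set \<Rightarrow> ('i \<Rightarrow> 'i \<Rightarrow> real) \<Rightarrow> bool" where
  "psd_on I \<kappa> \<longleftrightarrow> (\<forall>p\<in>I. \<forall>q\<in>I. \<kappa> p q = \<kappa> q p) \<and>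
     (\<forall>J c. finite J \<and> J \<subseteq> I \<longrightarrow> 0 \<le> (\<Sum>p\<in>J. \<Sum>q\<in>J. c p * c q * \<kappa> p q))"

lemma psd_on_nonneg:
  "psd_on I \<kappa> \<Longrightarrow> finite J \<Longrightarrow> J \<subseteq> I \<Longrightarrow> 0 \<le> (\<Sum>p\<in>J. \<Sum>q\<in>J. c p * c q * \<kappa> p q)"
  by (simp add: psd_on_def)

lemma psd_on_subset: "psd_on I \<kappa> \<Longrightarrow> J \<subseteq> I \<Longrightarrow> psd_on J \<kappa>"
  unfolding psd_on_def by (meson subsetD subset_trans)

text \<open>The homogeneous form in two variables also covers \<open>C = 0\<close>, where
  nonnegativity forces \<open>B = 0\<close>.\<close>

lemma nonneg_quadratic_discriminant:
  fixes A B C :: real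
  assumes "\<And>s t. 0 \<le> A * s\<^sup>2 + 2 * B * s * t + C * t\<^sup>2"
  shows "B\<^sup>2 \<le> A * C"
proof (cases "C > 0")
  case True
  have "0 \<le> C * (A * C - B\<^sup>2)"
    using assms[of C "-B"] by (simp add: power2_eq_square algebra_simps)
  then show ?thesis using True by (simp add: zero_le_mult_iff)
next
  case False
  then have C: "C = 0" using assms[of 0 1] by simp
  have "B = 0"
  proof (rule ccontr)
    assume "B \<noteq> 0"
    \<comment> \<open>For these arguments the form takes the value -1.\<close>
    then show False using assms[of 1 "- (A + 1) / (2 * B)"] C by simp
  qed
  then show ?thesis using C by simp
qed

text \<open>Extension of both coefficient families by 0 to the union of the index sets reduces the
  claim to the discriminant of the form at \<open>s * a' + t * b'\<close>.\<close>

lemma psd_on_Cauchy_Schwarz: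
  assumes psd: "psd_on I \<kappa>" and J: "finite J" "J \<subseteq> I" and J': "finite J'" "J' \<subseteq> I"
  shows "(\<Sum>p\<in>J. \<Sum>q\<in>J'. a p * b q * \<kappa> p q)\<^sup>2 \<le>
    (\<Sum>p\<in>J. \<Sum>q\<in>J. a p * a q * \<kappa> p q) * (\<Sum>p\<in>J'. \<Sum>q\<in>J'. b p * b q * \<kappa> p q)"
proof -
  define K where "K = J \<union> J'"
  have K: "finite K" "K \<subseteq> I" "J \<subseteq> K" "J' \<subseteq> K" using J J' by (auto simp: K_def)
  define a' where "a' p = (if p \<in> J then a p else 0)" for p
  define b' where "b' p = (if p \<in> J' then b p else 0)" for p
  define q where "q u w = (\<Sum>p\<in>K. \<Sum>q\<in>K. u p * w q * \<kappa> p q)" for u w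
  have red: "(\<Sum>p\<in>M. \<Sum>q\<in>N. u p * w q * \<kappa> p q)
      = q (\<lambda>p. if p \<in> M then u p else 0) (\<lambda>p. if p \<in> N then w p else 0)"
    if "M \<subseteq> K" "N \<subseteq> K" for M N and u w :: "'a \<Rightarrow> real"
  proof -
    have "(\<Sum>q\<in>N. u p * w q * \<kappa> p q) = (\<Sum>q\<in>K. u p * (if q \<in> N then w q else 0) * \<kappa> p q)" for p
      using that(2) K(1) by (intro sum.mono_neutral_cong_left) auto
    then have "(\<Sum>p\<in>M. \<Sum>q\<in>N. u p * w q * \<kappa> p q)
        = (\<Sum>p\<in>M. \<Sum>q\<in>K. u p * (if q \<in> N then w q else 0) * \<kappa> p q)" by (simp only:)
    also have "\<dots> = q (\<lambda>p. if p \<in> M then u p else 0) (\<lambda>p. if p \<in> N then w p else 0)"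
      unfolding q_def using that(1) K(1) by (intro sum.mono_neutral_cong_left) auto
    finally show ?thesis .
  qed
  have sym: "q b' a' = q a' b'"
  proof -
    have "q b' a' = (\<Sum>p\<in>K. \<Sum>r\<in>K. a' p * b' r * \<kappa> r p)"
      unfolding q_def by (subst sum.swap) (simp add: mult_ac)
    also have "\<dots> = q a' b'" unfolding q_def
      using psd K by (intro sum.cong refl) (auto simp: psd_on_def subset_iff)
    finally show ?thesis .
  qed
  have "0 \<le> q a' a' * s\<^sup>2 + 2 * q a' b' * s * t + q b' b' * t\<^sup>2" for s t
  proof -
    have "0 \<le> q (\<lambda>p. s * a' p + t * b' p) (\<lambda>p. s * a' p + t * b' p)"
      unfolding q_def using psd K(1,2) by (rule psd_on_nonneg)
    also have "\<dots> = s\<^sup>2 * q a' a' + s * t * q a' b' + s * t * q b' a' + t\<^sup>2 * q b' b'"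
      unfolding q_def sum_distrib_left sum.distrib[symmetric]
      by (intro sum.cong refl) (simp add: algebra_simps power2_eq_square)
    finally show ?thesis by (simp add: sym algebra_simps)
  qed
  then have "(q a' b')\<^sup>2 \<le> q a' a' * q b' b'" by (rule nonneg_quadratic_discriminant)
  then show ?thesis using K by (simp add: red a'_def[abs_def] b'_def[abs_def])
qed

lemma squeeze_zero_real:
  fixes a b :: "nat \<Rightarrow> real"
  assumes "\<And>n. \<bar>a n\<bar> \<le> b n" "b \<longlonglongrightarrow> 0"
  shows "a \<longlonglongrightarrow> 0"
  using assms Lim_null_comparison[of a b sequentially] by auto

text \<open>\<open>spd_kernel_on\<close> speaks of distinct points, while stencil points of
  different functionals may coincide. Coefficients at equal points are therefore added up in
  \<open>c\<close>; if all of these vanish, the sum is 0.\<close>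

lemma spd_kernel_on_indexed_nonneg:
  assumes spd: "spd_kernel_on S k" and J: "finite J" "\<And>j. j \<in> J \<Longrightarrow> x j \<in> S"
  shows "0 \<le> (\<Sum>i\<in>J. \<Sum>j\<in>J. d i * d j * k (x i) (x j))"
proof -
  define c where "c y = (\<Sum>j\<in>{j\<in>J. x j = y}. d j)" for y
  have collect: "(\<Sum>j\<in>J. d j * \<phi> (x j)) = (\<Sum>y\<in>x ` J. c y * \<phi> y)" for \<phi>
  proof -
    have "(\<Sum>j\<in>J. d j * \<phi> (x j)) = (\<Sum>y\<in>x ` J. \<Sum>j\<in>{j\<in>J. x j = y}. d j * \<phi> (x j))"
      using J(1) by (rule sum.image_gen)
    also have "\<dots> = (\<Sum>y\<in>x ` J. c y * \<phi> y)"
      unfolding c_def sum_distrib_right by (intro sum.cong refl) auto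
    finally show ?thesis .
  qed
  have "(\<Sum>i\<in>J. \<Sum>j\<in>J. d i * d j * k (x i) (x j)) = (\<Sum>i\<in>J. d i * (\<Sum>j\<in>J. d j * k (x i) (x j)))"
    by (simp add: sum_distrib_left mult.assoc)
  also have "\<dots> = (\<Sum>i\<in>J. d i * (\<Sum>y\<in>x ` J. c y * k (x i) y))"
    by (simp add: collect)
  also have "\<dots> = (\<Sum>z\<in>x ` J. \<Sum>y\<in>x ` J. c z * c y * k z y)"
    using collect[of "\<lambda>z. \<Sum>y\<in>x ` J. c y * k z y"] by (simp add: sum_distrib_left mult.assoc)
  also have "0 \<le> \<dots>"
  proof (cases "\<exists>y\<in>x ` J. c y \<noteq> 0")
    case True
    then have "0 < (\<Sum>z\<in>x ` J. \<Sum>y\<in>x ` J. c z * c y * k z y)"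
      using spd J unfolding spd_kernel_on_def by (simp add: image_subset_iff)
    then show ?thesis by simp
  qed (auto intro!: sum_nonneg)
  finally show ?thesis .
qed

section \<open>Inner product calculus and density of the kernel sections\<close>

locale rkhs =
  fixes k :: "'a \<Rightarrow> 'a \<Rightarrow> real" and S :: "'a set" and H :: "('a \<Rightarrow> real) set"
    and ip :: "('a \<Rightarrow> real) \<Rightarrow> ('a \<Rightarrow> real) \<Rightarrow> real"
  assumes is_rkhs: "is_rkhs k S H ip"
begin

lemma shows
  supported: "h \<in> H \<Longrightarrow> on_set S h = h" and
  zero_in: "(\<lambda>x. 0) \<in> H" and
  add_in: "h \<in> H \<Longrightarrow> l \<in> H \<Longrightarrow> (\<lambda>x. h x + l x) \<in> H" and
  scale_in: "h \<in> H \<Longrightarrow> (\<lambda>x. c * h x) \<in> H" and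
  ip_sym: "h \<in> H \<Longrightarrow> l \<in> H \<Longrightarrow> ip h l = ip l h" and
  ip_add: "h \<in> H \<Longrightarrow> l \<in> H \<Longrightarrow> w \<in> H \<Longrightarrow> ip (\<lambda>x. h x + l x) w = ip h w + ip l w" and
  ip_scale: "h \<in> H \<Longrightarrow> w \<in> H \<Longrightarrow> ip (\<lambda>x. c * h x) w = c * ip h w" and
  ip_nonneg: "h \<in> H \<Longrightarrow> 0 \<le> ip h h" and
  kernel_in: "x \<in> S \<Longrightarrow> on_set S (k x) \<in> H" and
  reproducing: "x \<in> S \<Longrightarrow> h \<in> H \<Longrightarrow> h x = ip (on_set S (k x)) h"
  using is_rkhs unfolding is_rkhs_def by blast+

lemma complete:
  assumes "\<And>n. F n \<in> H"
    and "\<And>e. e > 0 \<Longrightarrow> \<exists>n0::nat. \<forall>m\<ge>n0. \<forall>n\<ge>n0. ip (\<lambda>x. F m x - F n x) (\<lambda>x. F m x - F n x) < e"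
  shows "\<exists>h\<in>H. (\<lambda>n. ip (\<lambda>x. F n x - h x) (\<lambda>x. F n x - h x)) \<longlonglongrightarrow> 0"
  using is_rkhs assms unfolding is_rkhs_def by simp

lemma diff_in: "h \<in> H \<Longrightarrow> l \<in> H \<Longrightarrow> (\<lambda>x. h x - l x) \<in> H"
  using add_in[of h "\<lambda>x. (-1) * l x"] scale_in[of l "-1"] by simp

lemma sum_in: "finite I \<Longrightarrow> (\<And>i. i \<in> I \<Longrightarrow> F i \<in> H) \<Longrightarrow> (\<lambda>x. \<Sum>i\<in>I. c i * F i x) \<in> H"
proof (induction I rule: finite_induct)
  case (insert i I)
  then have "(\<lambda>x. c i * F i x + (\<Sum>i\<in>I. c i * F i x)) \<in> H"
    by (intro add_in scale_in) auto
  then show ?case using insert by simp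
qed (simp add: zero_in)

lemma ip_zero: "w \<in> H \<Longrightarrow> ip (\<lambda>x. 0) w = 0"
  using ip_scale[OF zero_in, of w 0] by simp

lemma ip_sum:
  assumes "finite I" "\<And>i. i \<in> I \<Longrightarrow> F i \<in> H" "w \<in> H"
  shows "ip (\<lambda>x. \<Sum>i\<in>I. c i * F i x) w = (\<Sum>i\<in>I. c i * ip (F i) w)"
  using assms(1,2)
proof (induction I rule: finite_induct)
  case (insert i I)
  have "ip (\<lambda>x. c i * F i x + (\<Sum>i\<in>I. c i * F i x)) w = c i * ip (F i) w + ip (\<lambda>x. \<Sum>i\<in>I. c i * F i x) w"
    using insert assms(3) by (simp add: ip_add ip_scale scale_in sum_in)
  then show ?case using insert by simp
qed (simp add: ip_zero assms)

lemma ip_sum_sum: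
  assumes "finite I" "\<And>i. i \<in> I \<Longrightarrow> F i \<in> H"
  shows "ip (\<lambda>x. \<Sum>i\<in>I. c i * F i x) (\<lambda>x. \<Sum>i\<in>I. c i * F i x) = (\<Sum>i\<in>I. \<Sum>j\<in>I. c i * c j * ip (F i) (F j))"
proof -
  let ?s = "\<lambda>x. \<Sum>i\<in>I. c i * F i x"
  have s: "?s \<in> H" using assms by (rule sum_in)
  have "ip ?s ?s = (\<Sum>i\<in>I. c i * ip ?s (F i))"
    using ip_sum[OF assms s] assms s by (auto intro!: sum.cong ip_sym)
  also have "\<dots> = (\<Sum>i\<in>I. c i * (\<Sum>j\<in>I. c j * ip (F i) (F j)))"
  proof (intro sum.cong refl arg_cong2[where f="(*)"])
    fix i assume "i \<in> I"
    then show "ip ?s (F i) = (\<Sum>j\<in>I. c j * ip (F i) (F j))"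
      using assms by (subst ip_sum) (auto intro!: sum.cong ip_sym)
  qed
  finally show ?thesis by (simp add: sum_distrib_left mult.assoc)
qed

lemma ip_lincomb:
  assumes "h \<in> H" "l \<in> H"
  shows "ip (\<lambda>x. a * h x + b * l x) (\<lambda>x. a * h x + b * l x) = a\<^sup>2 * ip h h + 2 * a * b * ip h l + b\<^sup>2 * ip l l"
proof -
  let ?s = "\<lambda>x. a * h x + b * l x"
  have s: "?s \<in> H" using assms by (intro add_in scale_in)
  have w: "ip ?s w = a * ip h w + b * ip l w" if "w \<in> H" for w
    using that assms by (simp add: ip_add ip_scale scale_in)
  show ?thesis using assms s
    by (simp add: w ip_sym[of _ ?s]) (simp add: ip_sym[of l h] algebra_simps power2_eq_square)
qed

lemma ip_diff_sq:
  assumes "h \<in> H" "l \<in> H"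
  shows "ip (\<lambda>x. h x - l x) (\<lambda>x. h x - l x) = ip h h - 2 * ip h l + ip l l"
  using ip_lincomb[OF assms, of 1 "-1"] by simp

lemma ip_Cauchy_Schwarz:
  assumes "h \<in> H" "l \<in> H"
  shows "(ip h l)\<^sup>2 \<le> ip h h * ip l l"
proof (rule nonneg_quadratic_discriminant)
  fix s t
  show "0 \<le> ip h h * s\<^sup>2 + 2 * ip h l * s * t + ip l l * t\<^sup>2"
    using ip_nonneg[of "\<lambda>x. s * h x + t * l x"] assms
    by (simp add: ip_lincomb add_in scale_in algebra_simps)
qed

definition kernel_span :: "('a \<Rightarrow> real) set" where
  "kernel_span = {g. \<exists>X c. finite X \<and> X \<subseteq> S \<and> g = (\<lambda>x. \<Sum>z\<in>X. c z * on_set S (k z) x)}"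

lemma kernel_span_in: "g \<in> kernel_span \<Longrightarrow> g \<in> H"
  by (auto simp: kernel_span_def intro!: sum_in kernel_in)

lemma kernel_span_lincomb:
  assumes "g \<in> kernel_span" "g' \<in> kernel_span"
  shows "(\<lambda>x. a * g x + b * g' x) \<in> kernel_span"
proof -
  obtain X c X' c' where X: "finite X" "X \<subseteq> S" "g = (\<lambda>x. \<Sum>z\<in>X. c z * on_set S (k z) x)"
    and X': "finite X'" "X' \<subseteq> S" "g' = (\<lambda>x. \<Sum>z\<in>X'. c' z * on_set S (k z) x)"
    using assms by (auto simp: kernel_span_def)
  have extend: "(\<Sum>z\<in>M. u z * on_set S (k z) x)
      = (\<Sum>z\<in>X \<union> X'. (if z \<in> M then u z else 0) * on_set S (k z) x)"
    if "M \<subseteq> X \<union> X'" for M u x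
    using that X X' by (intro sum.mono_neutral_cong_left) auto
  let ?c = "\<lambda>z. a * (if z \<in> X then c z else 0) + b * (if z \<in> X' then c' z else 0)"
  have "(\<lambda>x. a * g x + b * g' x) = (\<lambda>x. \<Sum>z\<in>X \<union> X'. ?c z * on_set S (k z) x)"
    unfolding X X' extend[of X c, OF Un_upper1] extend[of X' c', OF Un_upper2] sum_distrib_left sum.distrib[symmetric]
    by (intro ext sum.cong refl) (simp add: algebra_simps)
  then show ?thesis using X X' by (auto simp: kernel_span_def intro!: exI[of _ "X \<union> X'"] exI[of _ ?c])
qed

lemma kernel_in_span: "z \<in> S \<Longrightarrow> on_set S (k z) \<in> kernel_span"
  by (auto simp: kernel_span_def intro!: exI[of _ "{z}"] exI[of _ "\<lambda>_. 1"])

lemma zero_in_span: "(\<lambda>x. 0) \<in> kernel_span"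
  by (auto simp: kernel_span_def intro!: exI[of _ "{}"])

text \<open>A sequence in the span minimizing the distance to \<open>h\<close> is Cauchy by the parallelogram law.
  The limit of the differences to \<open>h\<close> vanishes on \<open>S\<close>, since moving along \<open>k z\<close> cannot decrease
  the distance below the infimum.\<close>

lemma kernel_span_dense:
  assumes h: "h \<in> H" and e: "e > 0"
  shows "\<exists>g\<in>kernel_span. ip (\<lambda>x. h x - g x) (\<lambda>x. h x - g x) < e"
proof -
  define N where "N g = ip (\<lambda>x. h x - g x) (\<lambda>x. h x - g x)" for g
  define d where "d = Inf (N ` kernel_span)"
  have N0: "0 \<le> N g" if "g \<in> kernel_span" for g
    unfolding N_def by (intro ip_nonneg diff_in h kernel_span_in[OF that])
  have bdd: "bdd_below (N ` kernel_span)" using N0 by (auto simp: bdd_below_def)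
  have dle: "d \<le> N g" if "g \<in> kernel_span" for g
    unfolding d_def using that bdd by (intro cInf_lower) auto
  have "\<exists>g. g \<in> kernel_span \<and> N g < d + 1 / Suc n" for n
  proof -
    have "Inf (N ` kernel_span) < d + 1 / Suc n" by (simp add: d_def)
    then show ?thesis using cInf_lessD[of "N ` kernel_span"] zero_in_span by auto
  qed
  then obtain G where G: "\<And>n. G n \<in> kernel_span" "\<And>n. N (G n) < d + 1 / Suc n" by metis
  define F where "F n = (\<lambda>x. h x - G n x)" for n
  have F: "F n \<in> H" for n using h G kernel_span_in by (simp add: F_def diff_in)
  have NF: "ip (F n) (F n) < d + 1 / Suc n" for n using G(2)[of n] by (simp add: N_def F_def)
  have cauchy: "ip (\<lambda>x. F m x - F n x) (\<lambda>x. F m x - F n x) < 2 / Suc m + 2 / Suc n" for m n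
  proof -
    have "d \<le> N (\<lambda>x. (1/2) * G m x + (1/2) * G n x)" using G by (intro dle kernel_span_lincomb)
    also have "\<dots> = ip (\<lambda>x. (1/2) * F m x + (1/2) * F n x) (\<lambda>x. (1/2) * F m x + (1/2) * F n x)"
      unfolding N_def by (rule arg_cong2[where f=ip]) (auto simp: F_def field_simps)
    also have "\<dots> = (1/4) * ip (F m) (F m) + (1/2) * ip (F m) (F n) + (1/4) * ip (F n) (F n)"
      by (subst ip_lincomb[OF F F]) (simp add: power2_eq_square)
    finally show ?thesis using NF[of m] NF[of n] by (simp add: ip_diff_sq[OF F F])
  qed
  have "\<exists>w\<in>H. (\<lambda>n. ip (\<lambda>x. F n x - w x) (\<lambda>x. F n x - w x)) \<longlonglongrightarrow> 0"
  proof (rule complete[OF F])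
    fix e :: real assume "e > 0"
    obtain n0 :: nat where n0: "4 / e < n0" using reals_Archimedean2 by blast
    have small: "2 / Suc m < e / 2" if "m \<ge> n0" for m
    proof -
      have "4 / e < Suc m" using n0 that by linarith
      then show ?thesis using \<open>e > 0\<close> by (simp add: field_simps)
    qed
    show "\<exists>n0::nat. \<forall>m\<ge>n0. \<forall>n\<ge>n0. ip (\<lambda>x. F m x - F n x) (\<lambda>x. F m x - F n x) < e"
    proof (intro exI allI impI)
      fix m n assume "n0 \<le> m" "n0 \<le> n"
      then show "ip (\<lambda>x. F m x - F n x) (\<lambda>x. F m x - F n x) < e"
        using cauchy[of m n] small[of m] small[of n] by linarith
    qed
  qed
  then obtain w where w: "w \<in> H" and lim: "(\<lambda>n. ip (\<lambda>x. F n x - w x) (\<lambda>x. F n x - w x)) \<longlonglongrightarrow> 0"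
    by auto
  have "w z = 0" for z
  proof (cases "z \<in> S")
    case True
    let ?k = "on_set S (k z)"
    have kz: "?k \<in> H" using True by (rule kernel_in)
    have vanish: "(\<lambda>n. F n z) \<longlonglongrightarrow> 0"
    proof -
      \<comment> \<open>\<open>1 / Suc n\<close> bounds the excess of the squared distance over the
        infimum \<open>d\<close>. A nearly minimal residual is nearly orthogonal to
        \<open>?k\<close>, and the discriminant makes this quantitative.\<close>
      have "(F n z)\<^sup>2 \<le> (1 / Suc n) * ip ?k ?k" for n
      proof (rule nonneg_quadratic_discriminant)
        fix s t :: real
        show "0 \<le> (1 / Suc n) * s\<^sup>2 + 2 * F n z * s * t + ip ?k ?k * t\<^sup>2"
        proof (cases "s = 0")
          case False
          have "d \<le> N (\<lambda>x. 1 * G n x + (- t / s) * ?k x)"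
            using G True by (intro dle kernel_span_lincomb kernel_in_span)
          also have "\<dots> = ip (\<lambda>x. 1 * F n x + (t / s) * ?k x) (\<lambda>x. 1 * F n x + (t / s) * ?k x)"
            unfolding N_def by (rule arg_cong2[where f=ip]) (auto simp: F_def)
          also have "\<dots> = ip (F n) (F n) + 2 * (t / s) * F n z + (t / s)\<^sup>2 * ip ?k ?k"
            by (subst ip_lincomb[OF F kz]) (simp add: reproducing[OF True F] ip_sym[OF kz F])
          finally have "0 \<le> 1 / Suc n + 2 * (t / s) * F n z + (t / s)\<^sup>2 * ip ?k ?k"
            using NF[of n] by linarith
          then have "0 \<le> s\<^sup>2 * (1 / Suc n + 2 * (t / s) * F n z + (t / s)\<^sup>2 * ip ?k ?k)" by simp
          also have "\<dots> = (1 / Suc n) * s\<^sup>2 + 2 * F n z * s * t + ip ?k ?k * t\<^sup>2"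
            using False by (simp add: field_simps power2_eq_square del: of_nat_Suc)
          finally show ?thesis .
        qed (simp add: ip_nonneg kz)
      qed
      then have "\<bar>(F n z)\<^sup>2\<bar> \<le> (1 / Suc n) * ip ?k ?k" for n by simp
      moreover have "(\<lambda>n. (1 / Suc n) * ip ?k ?k) \<longlonglongrightarrow> 0"
        using tendsto_mult_left_zero[OF LIMSEQ_inverse_real_of_nat] by (simp add: inverse_eq_divide)
      ultimately have "(\<lambda>n. (F n z)\<^sup>2) \<longlonglongrightarrow> 0"
        by (rule squeeze_zero_real)
      then show ?thesis by simp
    qed
    have "\<bar>(F n z - w z)\<^sup>2\<bar> \<le> ip ?k ?k * ip (\<lambda>x. F n x - w x) (\<lambda>x. F n x - w x)" for n
      using ip_Cauchy_Schwarz[OF kz diff_in[OF F w]] reproducing[OF True diff_in[OF F w]] by simp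
    moreover have "(\<lambda>n. ip ?k ?k * ip (\<lambda>x. F n x - w x) (\<lambda>x. F n x - w x)) \<longlonglongrightarrow> 0"
      using lim by (rule tendsto_mult_right_zero)
    ultimately have "(\<lambda>n. (F n z - w z)\<^sup>2) \<longlonglongrightarrow> 0"
      by (rule squeeze_zero_real)
    then have "(\<lambda>n. F n z) \<longlonglongrightarrow> w z" by (simp add: LIM_zero_iff)
    then show ?thesis using vanish LIMSEQ_unique by blast
  next
    case False
    then show ?thesis using supported[OF w] by (metis on_set_def)
  qed
  then have "w = (\<lambda>x. 0)" by auto
  then have "(\<lambda>n. N (G n)) \<longlonglongrightarrow> 0" using lim by (simp add: N_def F_def)
  then have "\<forall>\<^sub>F n in sequentially. N (G n) < e" using e by (rule order_tendstoD(2))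
  then obtain n where "N (G n) < e"
    using eventually_happens'[OF sequentially_bot] by blast
  then show ?thesis using G(1) by (auto simp: N_def)
qed

text \<open>A converse of the Cauchy-Schwarz inequality: by density the norm can be tested on the
  kernel span, and the inner product of \<open>h\<close> with an element of the span is a
  combination of values of \<open>h\<close>.\<close>

lemma norm_bound_of_values:
  assumes h: "h \<in> H" and M: "0 \<le> M"
    and bound: "\<And>X c. finite X \<Longrightarrow> X \<subseteq> S \<Longrightarrow>
      (\<Sum>z\<in>X. c z * h z)\<^sup>2 \<le> M * (\<Sum>z\<in>X. \<Sum>y\<in>X. c z * c y * k z y)"
  shows "ip h h \<le> M"
proof (rule field_le_epsilon)
  fix e :: real assume "e > 0"
  then obtain g where g: "g \<in> kernel_span" "ip (\<lambda>x. h x - g x) (\<lambda>x. h x - g x) < e"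
    using kernel_span_dense[OF h] by blast
  then obtain X c where X: "finite X" "X \<subseteq> S" and gdef: "g = (\<lambda>x. \<Sum>z\<in>X. c z * on_set S (k z) x)"
    by (auto simp: kernel_span_def)
  have gH: "g \<in> H" using g kernel_span_in by auto
  have kin: "on_set S (k z) \<in> H" if "z \<in> X" for z using that X kernel_in by auto
  have "ip g h = (\<Sum>z\<in>X. c z * h z)"
    unfolding gdef using X h
    by (subst ip_sum[OF X(1) kin h]) (auto intro!: sum.cong simp: reproducing[OF _ h, symmetric])
  moreover have "ip g g = (\<Sum>z\<in>X. \<Sum>y\<in>X. c z * c y * k z y)"
  proof -
    have "ip (on_set S (k z)) (on_set S (k y)) = k z y" if "z \<in> X" "y \<in> X" for z y
    proof -
      have zy: "z \<in> S" "y \<in> S" using that X by auto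
      have "ip (on_set S (k z)) (on_set S (k y)) = on_set S (k z) y"
        using reproducing[OF zy(2) kernel_in[OF zy(1)]] ip_sym[OF kin kin] that by simp
      then show ?thesis using zy by (simp add: on_set_def)
    qed
    then show ?thesis unfolding gdef by (subst ip_sum_sum[OF X(1) kin]) (auto intro!: sum.cong)
  qed
  ultimately have sq: "(ip h g)\<^sup>2 \<le> M * ip g g"
    using bound[OF X, of c] ip_sym[OF h gH] by simp
  \<comment> \<open>Arithmetic-geometric mean inequality. Together with the expansion of the squared
    norm of \<open>h - g\<close> it cancels \<open>ip g g\<close>.\<close>
  have "2 * ip h g \<le> M + ip g g"
  proof (rule power2_le_imp_le)
    have "(2 * ip h g)\<^sup>2 \<le> 4 * (M * ip g g)" using sq by (simp add: power_mult_distrib)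
    also have "\<dots> \<le> (M + ip g g)\<^sup>2"
      using zero_le_power2[of "M - ip g g"] by (simp add: power2_eq_square algebra_simps)
    finally show "(2 * ip h g)\<^sup>2 \<le> (M + ip g g)\<^sup>2" .
    show "0 \<le> M + ip g g" using M ip_nonneg[OF gH] by simp
  qed
  then show "ip h h \<le> M + e" using g(2) ip_diff_sq[OF h gH] by simp
qed

text \<open>\<open>H\<close> knows the form \<open>\<kappa>\<close> only through the point
  evaluations \<open>ev y\<close>. The combination \<open>h\<close> of the representers has values
  bounded by the Cauchy-Schwarz inequality for \<open>\<kappa>\<close>, so
  \<open>norm_bound_of_values\<close> bounds its norm in \<open>H\<close> by its norm in the form.
  This is an inequality, as passing to functions on \<open>S\<close> acts like a projection; pairing
  \<open>h\<close> with \<open>u\<close> gives the claim.\<close>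

lemma reproduced_functional_bound:
  assumes psd: "psd_on I \<kappa>" and ev: "inj_on ev S" "\<And>y. y \<in> S \<Longrightarrow> ev y \<in> I"
    and k: "\<And>y z. y \<in> S \<Longrightarrow> z \<in> S \<Longrightarrow> k y z = \<kappa> (ev y) (ev z)"
    and \<phi>: "\<And>p. p \<in> I \<Longrightarrow> \<phi> p \<in> H" "\<And>p y. p \<in> I \<Longrightarrow> y \<in> S \<Longrightarrow> \<phi> p y = \<kappa> p (ev y)"
    and u: "u \<in> H" and J: "finite J" "J \<subseteq> I"
  shows "(\<Sum>p\<in>J. c p * ip (\<phi> p) u)\<^sup>2 \<le> ip u u * (\<Sum>p\<in>J. \<Sum>q\<in>J. c p * c q * \<kappa> p q)"
proof -
  define h where "h = (\<lambda>x. \<Sum>p\<in>J. c p * \<phi> p x)"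
  define Q where "Q = (\<Sum>p\<in>J. \<Sum>q\<in>J. c p * c q * \<kappa> p q)"
  have \<phi>J: "\<phi> p \<in> H" if "p \<in> J" for p using that J \<phi> by auto
  have h: "h \<in> H" unfolding h_def using J(1) \<phi>J by (rule sum_in)
  have "ip h h \<le> Q"
  proof (rule norm_bound_of_values[OF h])
    show "0 \<le> Q" unfolding Q_def using psd J by (rule psd_on_nonneg)
    fix X and a :: "'a \<Rightarrow> real" assume X: "finite X" "X \<subseteq> S"
    have inj: "inj_on ev X" using ev(1) X(2) inj_on_subset by blast
    define b where "b p = a (the_inv_into X ev p)" for p
    have b: "b (ev z) = a z" if "z \<in> X" for z
      using that inj by (simp add: b_def the_inv_into_f_f)
    have "(\<Sum>z\<in>X. a z * h z) = (\<Sum>z\<in>X. \<Sum>p\<in>J. c p * a z * \<kappa> p (ev z))"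
      unfolding h_def sum_distrib_left
      using J X by (intro sum.cong refl) (auto simp: \<phi>(2) subset_iff)
    also have "\<dots> = (\<Sum>p\<in>J. \<Sum>q\<in>ev ` X. c p * b q * \<kappa> p q)"
      by (subst sum.swap) (simp add: sum.reindex[OF inj] b)
    finally have "(\<Sum>z\<in>X. a z * h z)\<^sup>2 \<le> Q * (\<Sum>p\<in>ev ` X. \<Sum>q\<in>ev ` X. b p * b q * \<kappa> p q)"
      unfolding Q_def using psd_on_Cauchy_Schwarz[OF psd J, of "ev ` X" c b] X ev(2) by auto
    also have "(\<Sum>p\<in>ev ` X. \<Sum>q\<in>ev ` X. b p * b q * \<kappa> p q) = (\<Sum>z\<in>X. \<Sum>y\<in>X. a z * a y * k z y)"
      using X by (simp add: sum.reindex[OF inj] b k subset_iff)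
    finally show "(\<Sum>z\<in>X. a z * h z)\<^sup>2 \<le> Q * (\<Sum>z\<in>X. \<Sum>y\<in>X. a z * a y * k z y)" .
  qed
  then have "ip h h * ip u u \<le> Q * ip u u" using ip_nonneg[OF u] by (rule mult_right_mono)
  moreover have "(ip h u)\<^sup>2 \<le> ip h h * ip u u" using h u by (rule ip_Cauchy_Schwarz)
  moreover have "ip h u = (\<Sum>p\<in>J. c p * ip (\<phi> p) u)"
    unfolding h_def using J(1) \<phi>J u by (rule ip_sum)
  ultimately show ?thesis by (simp add: Q_def mult.commute)
qed

end

text \<open>The squared norm \<open>N\<close> of the interpolant equals \<open>l\<close> applied to
  its coefficients, because \<open>s\<close> agrees with \<open>l\<close> on \<open>Z\<close>. Hence
  \<open>N\<^sup>2 \<le> M * N\<close> and \<open>N \<le> M\<close>, whatever \<open>Z\<close> is.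
  So \<open>s\<close> obeys the same difference bound as \<open>l\<close>, and the factor 4 comes
  from \<open>(a - b)\<^sup>2 \<le> 2 * a\<^sup>2 + 2 * b\<^sup>2\<close>.\<close>

lemma interpolation_error_difference_bound:
  assumes psd: "psd_on I \<kappa>" and M: "0 \<le> M"
    and l: "\<And>J c. finite J \<Longrightarrow> J \<subseteq> I \<Longrightarrow>
      (\<Sum>p\<in>J. c p * l p)\<^sup>2 \<le> M * (\<Sum>p\<in>J. \<Sum>q\<in>J. c p * c q * \<kappa> p q)"
    and Z: "finite Z" "Z \<subseteq> I"
    and s: "\<And>p. p \<in> I \<Longrightarrow> s p = (\<Sum>r\<in>Z. \<sigma> r * \<kappa> r p)" "\<And>p. p \<in> Z \<Longrightarrow> s p = l p"
    and pq: "p \<in> I" "q \<in> I"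
  shows "((l p - s p) - (l q - s q))\<^sup>2 \<le> 4 * M * (\<kappa> p p - \<kappa> p q - \<kappa> q p + \<kappa> q q)"
proof (cases "p = q")
  case False
  define J where "J = {p, q}"
  define c :: "'a \<Rightarrow> real" where "c x = (if x = p then 1 else -1)" for x
  have J: "finite J" "J \<subseteq> I" using pq by (auto simp: J_def)
  have Q: "(\<Sum>x\<in>J. \<Sum>y\<in>J. c x * c y * \<kappa> x y) = \<kappa> p p - \<kappa> p q - \<kappa> q p + \<kappa> q q" (is "?Q = _")
    using False by (simp add: J_def c_def)
  have Q0: "0 \<le> ?Q" using psd J by (rule psd_on_nonneg)
  define N where "N = (\<Sum>r\<in>Z. \<Sum>t\<in>Z. \<sigma> r * \<sigma> t * \<kappa> r t)"
  have "N = (\<Sum>t\<in>Z. \<sigma> t * s t)"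
    unfolding N_def using Z s(1) by (subst sum.swap) (simp add: sum_distrib_left mult_ac subset_iff)
  also have "\<dots> = (\<Sum>t\<in>Z. \<sigma> t * l t)" by (simp add: s(2))
  finally have "N\<^sup>2 \<le> M * N" using l[OF Z, of \<sigma>] by (simp add: N_def)
  moreover have "0 \<le> N" unfolding N_def using psd Z by (rule psd_on_nonneg)
  ultimately have NM: "N \<le> M" using M
    by (cases "N = 0") (auto simp: power2_eq_square)
  have "(s p - s q)\<^sup>2 = (\<Sum>r\<in>Z. \<Sum>x\<in>J. \<sigma> r * c x * \<kappa> r x)\<^sup>2"
    using False pq by (simp add: s(1) J_def c_def sum_subtractf)
  also have "\<dots> \<le> N * ?Q" unfolding N_def using psd Z J by (rule psd_on_Cauchy_Schwarz)
  also have "\<dots> \<le> M * ?Q" using NM Q0 by (rule mult_right_mono)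
  finally have B: "(s p - s q)\<^sup>2 \<le> M * ?Q" .
  have A: "(l p - l q)\<^sup>2 \<le> M * ?Q"
    using l[OF J, of c] False by (simp add: J_def c_def)
  have "((l p - s p) - (l q - s q))\<^sup>2 \<le> 2 * (l p - l q)\<^sup>2 + 2 * (s p - s q)\<^sup>2"
    using zero_le_power2[of "(l p - l q) + (s p - s q)"]
    by (simp add: power2_eq_square algebra_simps)
  then show ?thesis using A B by (simp add: Q)
qed simp

section \<open>The kernel of values and partial derivatives\<close>

text \<open>With one index type for values and partials, the two kinds of Hermite conditions become
  a single family of functionals.\<close>

definition jet :: "(real^'n \<Rightarrow> real) \<Rightarrow> (real^'n) \<times> 'n option \<Rightarrow> real" where
  "jet h p = (case snd p of None \<Rightarrow> h (fst p) | Some i \<Rightarrow> grad h (fst p) $ i)"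

text \<open>The Gram kernel of these functionals: \<open>p\<close> acts on the first argument, then
  \<open>q\<close> on the second. Symmetry is not evident from this order; it is inherited from the
  stencil kernels in the limit.\<close>

definition jet_kernel ::
  "(real^'n \<Rightarrow> real^'n \<Rightarrow> real) \<Rightarrow> (real^'n) \<times> 'n option \<Rightarrow> (real^'n) \<times> 'n option \<Rightarrow> real" where
  "jet_kernel k p q = jet (\<lambda>y. jet (\<lambda>x. k x y) p) q"

lemma jet_simps [simp]: "jet h (x, None) = h x" "jet h (x, Some i) = grad h x $ i"
  by (simp_all add: jet_def)

lemma grad_nth_eq: "(h has_derivative h') (at x) \<Longrightarrow> grad h x $ i = h' (axis i 1)"
  by (metis grad_def frechet_derivative_at vec_lambda_beta)

text \<open>The same functionals as operators on the uncurried kernel, where \<open>C_on\<close>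
  applies and orders of smoothness can be counted.\<close>

definition partial :: "('i \<Rightarrow> 'a) \<Rightarrow> 'i option \<Rightarrow> ('a::euclidean_space \<Rightarrow> real) \<Rightarrow> 'a \<Rightarrow> real" where
  "partial d a h = (case a of None \<Rightarrow> h | Some i \<Rightarrow> dird h (d i))"

abbreviation fst_axis :: "'n \<Rightarrow> (real^'n) \<times> (real^'n)" where "fst_axis i \<equiv> (axis i 1, 0)"
abbreviation snd_axis :: "'n \<Rightarrow> (real^'n) \<times> (real^'n)" where "snd_axis i \<equiv> (0, axis i 1)"

lemma C_on_partial: "C_on (Suc m) h V \<Longrightarrow> C_on m (partial d a h) V"
  by (cases a) (auto simp: partial_def intro: C_on_SucD)

context
  fixes k :: "real^'n \<Rightarrow> real^'n \<Rightarrow> real" and V :: "((real^'n) \<times> (real^'n)) set"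
  assumes V: "open V" and C: "C_on 2 (\<lambda>(x, y). k x y) V"
begin

lemma jet_fst_eq:
  assumes "(x, y) \<in> V"
  shows "jet (\<lambda>x. k x y) (x, a) = partial fst_axis a (\<lambda>(x, y). k x y) (x, y)"
proof (cases a)
  case (Some i)
  have "(\<lambda>(x, y). k x y) differentiable (at (x, y))"
    using C assms by (simp add: numeral_2_eq_2)
  from has_derivative_fst_slice[OF this] show ?thesis
    by (simp add: Some partial_def grad_nth_eq)
qed (simp add: partial_def)

lemma jet_fst_has_derivative:
  assumes xy: "(x, y) \<in> V"
  shows "((\<lambda>y. jet (\<lambda>x. k x y) (x, a)) has_derivative
    (\<lambda>d. dird (partial fst_axis a (\<lambda>(x, y). k x y)) (0, d) (x, y))) (at y)"
proof (rule has_derivative_transform_within_open)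
  have "C_on 1 (partial fst_axis a (\<lambda>(x, y). k x y)) V"
    using C by (intro C_on_partial) (simp add: numeral_2_eq_2)
  then have "partial fst_axis a (\<lambda>(x, y). k x y) differentiable (at (x, y))"
    using xy by simp
  then show "((\<lambda>y. partial fst_axis a (\<lambda>(x, y). k x y) (x, y)) has_derivative
    (\<lambda>d. dird (partial fst_axis a (\<lambda>(x, y). k x y)) (0, d) (x, y))) (at y)"
    by (rule has_derivative_snd_slice)
  show "open (Pair x -` V)"
    using V by (intro open_vimage) (auto intro!: continuous_intros)
qed (use xy jet_fst_eq in auto)

lemma jet_kernel_eq:
  assumes "(x, y) \<in> V"
  shows "jet_kernel k (x, a) (y, b)
    = partial snd_axis b (partial fst_axis a (\<lambda>(x, y). k x y)) (x, y)"
proof (cases b)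
  case None
  then show ?thesis using jet_fst_eq[OF assms] by (simp add: jet_kernel_def partial_def[of _ None])
next
  case (Some j)
  then show ?thesis using grad_nth_eq[OF jet_fst_has_derivative[OF assms]]
    by (simp add: jet_kernel_def partial_def[of _ "Some _"])
qed

end

text \<open>One derivative in each argument leaves a function of class \<open>C_on 2\<close>, to
  which the second difference bound applies. The finitely many functionals at a point are covered by
  the sum of their constants.\<close>

lemma jet_kernel_difference_bound:
  fixes k :: "real^'n \<Rightarrow> real^'n \<Rightarrow> real"
  assumes V: "open V" and C: "C_on 4 (\<lambda>(x, y). k x y) V"
    and K: "compact K" "convex K" "K \<times> K \<subseteq> V"
  obtains L where "L \<ge> 0"
    "\<And>x y a. x \<in> K \<Longrightarrow> y \<in> K \<Longrightarrow>
      jet_kernel k (x, a) (x, a) - jet_kernel k (x, a) (y, a)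
        - jet_kernel k (y, a) (x, a) + jet_kernel k (y, a) (y, a) \<le> L * (norm (x - y))\<^sup>2"
proof -
  have C2: "C_on 2 (\<lambda>(x, y). k x y) V" using C by (rule C_on_mono[rotated]) simp
  have "\<exists>L\<ge>0. \<forall>x\<in>K. \<forall>y\<in>K. jet_kernel k (x, a) (x, a) - jet_kernel k (x, a) (y, a)
        - jet_kernel k (y, a) (x, a) + jet_kernel k (y, a) (y, a) \<le> L * (norm (x - y))\<^sup>2" for a
  proof -
    have "C_on (Suc (Suc 2)) (\<lambda>(x, y). k x y) V" using C by simp
    then have "C_on 2 (partial snd_axis a (partial fst_axis a (\<lambda>(x, y). k x y))) V"
      by (intro C_on_partial)
    from C_on_2_second_difference_bound[OF this K] obtain L where "L \<ge> 0"
      "\<And>x y. x \<in> K \<Longrightarrow> y \<in> K \<Longrightarrow>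
        partial snd_axis a (partial fst_axis a (\<lambda>(x, y). k x y)) (x, x)
        - partial snd_axis a (partial fst_axis a (\<lambda>(x, y). k x y)) (x, y)
        - partial snd_axis a (partial fst_axis a (\<lambda>(x, y). k x y)) (y, x)
        + partial snd_axis a (partial fst_axis a (\<lambda>(x, y). k x y)) (y, y) \<le> L * (norm (x - y))\<^sup>2"
      by blast
    then show ?thesis using K(3) jet_kernel_eq[OF V C2]
      by (intro exI[of _ L]) (auto simp: subset_iff)
  qed
  then obtain l where l: "\<And>a. l a \<ge> 0"
    "\<And>a x y. x \<in> K \<Longrightarrow> y \<in> K \<Longrightarrow> jet_kernel k (x, a) (x, a) - jet_kernel k (x, a) (y, a)
        - jet_kernel k (y, a) (x, a) + jet_kernel k (y, a) (y, a) \<le> l a * (norm (x - y))\<^sup>2"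
    by metis
  show ?thesis
  proof (rule that[of "\<Sum>a\<in>UNIV. l a"])
    show "0 \<le> (\<Sum>a\<in>UNIV. l a)" using l(1) by (simp add: sum_nonneg)
    fix x y a assume xy: "x \<in> K" "y \<in> K"
    have "l a \<le> (\<Sum>a\<in>UNIV. l a)" using l(1) by (intro member_le_sum) auto
    then have "l a * (norm (x - y))\<^sup>2 \<le> (\<Sum>a\<in>UNIV. l a) * (norm (x - y))\<^sup>2"
      by (intro mult_right_mono) auto
    then show "jet_kernel k (x, a) (x, a) - jet_kernel k (x, a) (y, a)
        - jet_kernel k (y, a) (x, a) + jet_kernel k (y, a) (y, a)
        \<le> (\<Sum>a\<in>UNIV. l a) * (norm (x - y))\<^sup>2"
      using l(2)[OF xy, of a] by linarith
  qed
qed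

text \<open>Difference stencils for values and derivatives, of step \<open>t\<close>, at shifted base points \<open>w\<close>:
  only a limit of them need be centred in the region where the kernel is positive definite.\<close>

definition stencil_point ::
  "(real^'n \<Rightarrow> real^'n) \<Rightarrow> real \<Rightarrow> (real^'n) \<times> 'n option \<Rightarrow> bool \<Rightarrow> real^'n" where
  "stencil_point w t p b = (case snd p of None \<Rightarrow> w (fst p)
     | Some i \<Rightarrow> w (fst p) + (if b then t else 0) *\<^sub>R axis i 1)"

definition stencil_weight :: "real \<Rightarrow> (real^'n) \<times> 'n option \<Rightarrow> bool \<Rightarrow> real" where
  "stencil_weight t p b = (case snd p of None \<Rightarrow> (if b then 1 else 0)
     | Some i \<Rightarrow> (if b then 1 / t else - (1 / t)))"

definition stencil_kernel ::
  "(real^'n \<Rightarrow> real^'n) \<Rightarrow> real \<Rightarrow> (real^'n \<Rightarrow> real^'n \<Rightarrow> real)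
    \<Rightarrow> (real^'n) \<times> 'n option \<Rightarrow> (real^'n) \<times> 'n option \<Rightarrow> real" where
  "stencil_kernel w t k p q = (\<Sum>a\<in>UNIV. \<Sum>b\<in>UNIV.
     stencil_weight t p a * stencil_weight t q b * k (stencil_point w t p a) (stencil_point w t q b))"

text \<open>Expanding the stencils gives the quadratic form of \<open>k\<close> itself at the
  stencil points, with coefficients \<open>c p * stencil_weight t p a\<close>.\<close>

lemma stencil_kernel_psd:
  fixes I :: "((real^'n) \<times> 'n option) set"
  assumes spd: "spd_kernel_on P k" and P: "\<And>p b. p \<in> I \<Longrightarrow> stencil_point w t p b \<in> P"
  shows "psd_on I (stencil_kernel w t k)"
  unfolding psd_on_def
proof (intro conjI ballI allI impI)
  fix p q assume pq: "p \<in> I" "q \<in> I"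
  have sym: "k (stencil_point w t p a) (stencil_point w t q b)
      = k (stencil_point w t q b) (stencil_point w t p a)" for a b
    using spd P pq by (simp add: spd_kernel_on_def)
  show "stencil_kernel w t k p q = stencil_kernel w t k q p"
    unfolding stencil_kernel_def by (subst sum.swap) (simp add: sym mult.commute)
next
  fix J :: "((real^'n) \<times> 'n option) set" and c assume J: "finite J \<and> J \<subseteq> I"
  let ?x = "\<lambda>(p :: (real^'n) \<times> 'n option, a). stencil_point w t p a"
  let ?d = "\<lambda>(p :: (real^'n) \<times> 'n option, a). c p * stencil_weight t p a"
  have "0 \<le> (\<Sum>i\<in>J \<times> UNIV. \<Sum>j\<in>J \<times> UNIV. ?d i * ?d j * k (?x i) (?x j))"
    by (rule spd_kernel_on_indexed_nonneg[OF spd]) (use J P in auto)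
  also have "\<dots> = (\<Sum>p\<in>J. \<Sum>a\<in>UNIV. \<Sum>q\<in>J. \<Sum>b\<in>UNIV.
      ?d (p, a) * ?d (q, b) * k (?x (p, a)) (?x (q, b)))"
    by (simp only: sum.cartesian_product')
  also have "\<dots> = (\<Sum>p\<in>J. \<Sum>q\<in>J. c p * c q * stencil_kernel w t k p q)"
    unfolding stencil_kernel_def sum_distrib_left
    by (subst sum.swap) (simp add: mult_ac)
  finally show "0 \<le> (\<Sum>p\<in>J. \<Sum>q\<in>J. c p * c q * stencil_kernel w t k p q)" .
qed

lemma stencil_kernel_tendsto:
  fixes k :: "real^'n \<Rightarrow> real^'n \<Rightarrow> real"
  assumes V: "open V" and C: "C_on 2 (\<lambda>(x, y). k x y) V" and z: "(z, z') \<in> V"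
    and w: "(\<lambda>n. w n z) \<longlonglongrightarrow> z" "(\<lambda>n. w n z') \<longlonglongrightarrow> z'"
    and t: "t \<longlonglongrightarrow> 0" "\<And>n. t n > 0"
  shows "(\<lambda>n. stencil_kernel (w n) (t n) k (z, a) (z', b)) \<longlonglongrightarrow> jet_kernel k (z, a) (z', b)"
proof -
  let ?k = "\<lambda>(x, y). k x y"
  have C1: "C_on 1 ?k V" using C by (rule C_on_mono[rotated]) simp
  have P: "(\<lambda>n. (w n z, w n z')) \<longlonglongrightarrow> (z, z')" using w by (rule tendsto_Pair)
  note d = difference_quotient_tendsto[OF C1 V z P t]
  show ?thesis
  proof (cases a)
    case None
    show ?thesis
    proof (cases b)
      case bNone: None
      have "isCont ?k (z, z')"
        using C_on_continuous[OF C] V z by (simp add: continuous_on_eq_continuous_at)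
      from isCont_tendsto_compose[OF this P] show ?thesis
        by (simp add: None bNone stencil_kernel_def stencil_point_def stencil_weight_def
            UNIV_bool jet_kernel_def)
    next
      case (Some j)
      show ?thesis using d[of "snd_axis j"] t(2)
        by (simp add: None Some stencil_kernel_def stencil_point_def stencil_weight_def
            UNIV_bool jet_kernel_eq[OF V C z] partial_def diff_divide_distrib)
    qed
  next
    case (Some i)
    show ?thesis
    proof (cases b)
      case None
      show ?thesis using d[of "fst_axis i"] t(2)
        by (simp add: None Some stencil_kernel_def stencil_point_def stencil_weight_def
            UNIV_bool jet_kernel_eq[OF V C z] partial_def diff_divide_distrib)
    next
      case bSome: (Some j)
      show ?thesis
        using mixed_difference_quotient_tendsto[OF C V z P t, of "fst_axis i" "snd_axis j"] t(2)
        by (simp add: bSome Some stencil_kernel_def stencil_point_def stencil_weight_def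
            UNIV_bool jet_kernel_eq[OF V C z] partial_def diff_divide_distrib add_divide_distrib algebra_simps)
    qed
  qed
qed

lemma psd_on_limit:
  assumes psd: "\<And>n::nat. psd_on I (\<kappa> n)"
    and lim: "\<And>p q. p \<in> I \<Longrightarrow> q \<in> I \<Longrightarrow> (\<lambda>n. \<kappa> n p q) \<longlonglongrightarrow> \<kappa>' p q"
  shows "psd_on I \<kappa>'"
  unfolding psd_on_def
proof (intro conjI ballI allI impI)
  fix p q assume pq: "p \<in> I" "q \<in> I"
  have "\<kappa> n q p = \<kappa> n p q" for n using psd pq by (auto simp: psd_on_def)
  then have "(\<lambda>n. \<kappa> n p q) \<longlonglongrightarrow> \<kappa>' q p" using lim[OF pq(2,1)] by simp
  then show "\<kappa>' p q = \<kappa>' q p" using lim[OF pq] LIMSEQ_unique by blast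
next
  fix J c assume J: "finite J \<and> J \<subseteq> I"
  have "(\<lambda>n. \<Sum>p\<in>J. \<Sum>q\<in>J. c p * c q * \<kappa> n p q) \<longlonglongrightarrow> (\<Sum>p\<in>J. \<Sum>q\<in>J. c p * c q * \<kappa>' p q)"
    using J by (intro tendsto_sum tendsto_mult_left lim) auto
  then show "0 \<le> (\<Sum>p\<in>J. \<Sum>q\<in>J. c p * c q * \<kappa>' p q)"
    by (rule LIMSEQ_le_const) (use J psd psd_on_nonneg in blast)
qed

text \<open>If \<open>K\<close> contains a ball of radius \<open>d\<close> around \<open>c\<close>,
  the contraction towards \<open>c\<close> with ratio \<open>1 - \<mu> n\<close> makes room: by
  convexity the ball of radius \<open>\<mu> n * d\<close> around each image stays in
  \<open>K\<close>, and this is the step \<open>t n\<close>. If \<open>K\<close> has no interior,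
  the base points stay fixed and the stencils use the neighbourhood \<open>U\<close>.\<close>

lemma approximating_stencils:
  fixes K :: "(real^'n) set"
  assumes K: "compact K" "convex K" and spd: "spd_kernel_on K k"
    and flat: "interior K = {} \<longrightarrow> (\<exists>U. open U \<and> K \<subseteq> U \<and> spd_kernel_on U k)"
  shows "\<exists>P w t. spd_kernel_on P k \<and> (\<forall>n. t n > 0) \<and> t \<longlonglongrightarrow> 0 \<and> (\<forall>z\<in>K. (\<lambda>n. w n z) \<longlonglongrightarrow> z) \<and>
    (\<forall>n::nat. \<forall>z\<in>K. w n z \<in> P \<and> (\<forall>i. w n z + t n *\<^sub>R axis i 1 \<in> P))"
proof (cases "interior K = {}")
  case True
  then obtain U where U: "open U" "K \<subseteq> U" "spd_kernel_on U k" using flat by blast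
  obtain e where e: "e > 0" "(\<Union>x\<in>K. ball x e) \<subseteq> U"
    using compact_subset_open_imp_ball_epsilon_subset[OF K(1) U(1,2)] by blast
  \<comment> \<open>The half keeps the step below \<open>e\<close> already at
    \<open>n = 0\<close>.\<close>
  define t where "t n = inverse (Suc n) * (e / 2)" for n
  have t: "0 < t n" "t n < e" for n
  proof -
    show "0 < t n" using e by (simp add: t_def)
    have "inverse (real (Suc n)) \<le> 1" by (simp add: inverse_le_1_iff)
    then have "t n \<le> 1 * (e / 2)" unfolding t_def using e by (intro mult_right_mono) auto
    then show "t n < e" using e by simp
  qed
  have "t \<longlonglongrightarrow> 0" unfolding t_def[abs_def]
    by (rule tendsto_mult_left_zero[OF LIMSEQ_inverse_real_of_nat])
  moreover have "z + t n *\<^sub>R axis i 1 \<in> U" if "z \<in> K" for z n i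
  proof -
    have "z + t n *\<^sub>R axis i 1 \<in> ball z e" using t[of n] by (simp add: dist_norm)
    then show ?thesis using e that by blast
  qed
  ultimately show ?thesis using U t(1)
    by (intro exI[of _ U] exI[of _ "\<lambda>n z. z"] exI[of _ t]) auto
next
  case False
  then obtain c d where d: "d > 0" "cball c d \<subseteq> K"
    by (metis all_not_in_conv mem_interior_cball)
  define \<mu> :: "nat \<Rightarrow> real" where "\<mu> n = inverse (Suc n)" for n
  have \<mu>: "0 < \<mu> n" "\<mu> n \<le> 1" for n by (auto simp: \<mu>_def inverse_le_1_iff)
  have \<mu>0: "\<mu> \<longlonglongrightarrow> 0" unfolding \<mu>_def[abs_def] by (rule LIMSEQ_inverse_real_of_nat)
  define t where "t n = \<mu> n * d" for n
  define w where "w n z = (1 - \<mu> n) *\<^sub>R z + \<mu> n *\<^sub>R c" for n z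
  have in_K: "(1 - \<mu> n) *\<^sub>R z + \<mu> n *\<^sub>R y \<in> K" if "z \<in> K" "y \<in> cball c d" for n z y
    using convexD_alt[OF K(2), of z y "\<mu> n"] that d \<mu>[of n] by auto
  have "w n z \<in> K" if "z \<in> K" for n z unfolding w_def using that d by (intro in_K) auto
  moreover have "w n z + t n *\<^sub>R axis i 1 \<in> K" if "z \<in> K" for n z i
  proof -
    have "w n z + t n *\<^sub>R axis i 1 = (1 - \<mu> n) *\<^sub>R z + \<mu> n *\<^sub>R (c + d *\<^sub>R axis i 1)"
      by (simp add: w_def t_def algebra_simps)
    also have "\<dots> \<in> K" using that d by (intro in_K) (auto simp: dist_norm)
    finally show ?thesis .
  qed
  moreover have "t \<longlonglongrightarrow> 0" unfolding t_def[abs_def] using \<mu>0 by (rule tendsto_mult_left_zero)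
  moreover have "(\<lambda>n. w n z) \<longlonglongrightarrow> z" for z
  proof -
    have "(\<lambda>n. w n z) \<longlonglongrightarrow> (1 - 0) *\<^sub>R z + 0 *\<^sub>R c"
      unfolding w_def by (intro tendsto_add tendsto_scaleR tendsto_diff tendsto_const \<mu>0)
    then show ?thesis by simp
  qed
  moreover have "t n > 0" for n using \<mu> d by (simp add: t_def)
  ultimately show ?thesis using spd
    by (intro exI[of _ K] exI[of _ w] exI[of _ t]) auto
qed

lemma jet_kernel_psd:
  fixes k :: "real^'n \<Rightarrow> real^'n \<Rightarrow> real"
  assumes V: "open V" and C: "C_on 2 (\<lambda>(x, y). k x y) V" and KV: "K \<times> K \<subseteq> V"
    and K: "compact K" "convex K" and spd: "spd_kernel_on K k"
    and flat: "interior K = {} \<longrightarrow> (\<exists>U. open U \<and> K \<subseteq> U \<and> spd_kernel_on U k)"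
  shows "psd_on (K \<times> UNIV) (jet_kernel k)"
proof -
  obtain P w t where P: "spd_kernel_on P k" and t: "\<And>n. t n > 0" "t \<longlonglongrightarrow> 0"
    and w: "\<And>z. z \<in> K \<Longrightarrow> (\<lambda>n. w n z) \<longlonglongrightarrow> z" "\<And>n z. z \<in> K \<Longrightarrow> w n z \<in> P"
      "\<And>n z i. z \<in> K \<Longrightarrow> w n z + t n *\<^sub>R axis i 1 \<in> P"
    using approximating_stencils[OF K spd flat] by blast
  show ?thesis
  proof (rule psd_on_limit)
    show "psd_on (K \<times> UNIV) (stencil_kernel (w n) (t n) k)" for n
      by (rule stencil_kernel_psd[OF P]) (auto simp: stencil_point_def w split: option.split)
    show "(\<lambda>n. stencil_kernel (w n) (t n) k p q) \<longlonglongrightarrow> jet_kernel k p q"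
      if "p \<in> K \<times> UNIV" "q \<in> K \<times> UNIV" for p q
      using stencil_kernel_tendsto[OF V C, of "fst p" "fst q" w t "snd p" "snd q"] that KV w(1) t
      by auto
  qed
qed

text \<open>Collecting \<open>\<alpha>\<close> and \<open>\<beta>\<close> in one family
  \<open>\<sigma>\<close> makes the interpolant a combination of sections of
  \<open>jet_kernel\<close>, also after differentiation in the second argument. This is the form
  needed for the norm comparison.\<close>

lemma hermite_interpolant_jet:
  fixes k :: "real^'n \<Rightarrow> real^'n \<Rightarrow> real"
  assumes V: "open V" and C: "C_on 2 (\<lambda>(x, y). k x y) V" and KV: "K \<times> K \<subseteq> V"
    and s: "hermite_interpolant k v X s" and X: "X \<subseteq> K"
  obtains \<sigma> where "\<And>q. q \<in> K \<times> UNIV \<Longrightarrow> jet s q = (\<Sum>p\<in>X \<times> UNIV. \<sigma> p * jet_kernel k p q)"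
    "\<And>p. p \<in> X \<times> UNIV \<Longrightarrow> jet s p = jet v p"
proof -
  obtain \<alpha> \<beta> where fin: "finite X" and sdef: "s = (\<lambda>x. \<Sum>y\<in>X. \<alpha> y * k y x + \<beta> y \<bullet> grad1 k y x)"
    and interp: "\<And>y. y \<in> X \<Longrightarrow> s y = v y \<and> grad s y = grad v y"
    using s by (auto simp: hermite_interpolant_def)
  define \<sigma> where "\<sigma> p = (case snd p of None \<Rightarrow> \<alpha> (fst p) | Some i \<Rightarrow> \<beta> (fst p) $ i)" for p
  have s_eq: "s = (\<lambda>x. \<Sum>p\<in>X \<times> UNIV. \<sigma> p * jet (\<lambda>z. k z x) p)"
    unfolding sdef sum.cartesian_product' UNIV_option_conv
    by (simp add: sum.reindex \<sigma>_def inner_vec_def grad1_def)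
  show ?thesis
  proof (rule that[of \<sigma>])
    fix q :: "(real^'n) \<times> 'n option" assume "q \<in> K \<times> UNIV"
    then obtain x b where q: "q = (x, b)" "x \<in> K" by auto
    show "jet s q = (\<Sum>p\<in>X \<times> UNIV. \<sigma> p * jet_kernel k p q)"
    proof (cases b)
      case None
      then show ?thesis by (simp add: q s_eq jet_kernel_def)
    next
      case (Some j)
      have in_V: "(fst p, x) \<in> V" if "p \<in> X \<times> UNIV" for p
        by (rule subsetD[OF KV]) (use that X q in auto)
      have "((\<lambda>x. jet (\<lambda>z. k z x) p) has_derivative
          (\<lambda>d. dird (partial fst_axis (snd p) (\<lambda>(x, y). k x y)) (0, d) (fst p, x))) (at x)"
        if "p \<in> X \<times> UNIV" for p
        using jet_fst_has_derivative[OF V C in_V[OF that], of "snd p"] by simp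
      then have "(s has_derivative (\<lambda>d. \<Sum>p\<in>X \<times> UNIV. \<sigma> p *
          dird (partial fst_axis (snd p) (\<lambda>(x, y). k x y)) (0, d) (fst p, x))) (at x)"
        unfolding s_eq by (intro has_derivative_sum has_derivative_mult_right) auto
      from grad_nth_eq[OF this] show ?thesis
        using jet_kernel_eq[OF V C in_V]
        by (auto simp: q Some partial_def[of _ "Some j"] intro!: sum.cong)
    qed
  next
    fix p assume "p \<in> X \<times> (UNIV :: 'n option set)"
    then show "jet s p = jet v p" using interp by (auto simp: jet_def split: option.split)
  qed
qed

section \<open>Trajectories and the greedy algorithms\<close>

text \<open>Product rule for Lipschitz functions; compactness of \<open>S\<close> supplies the
  bounds on the factors. The feedback and the closed-loop field are built from such
  products.\<close>

lemma bounded_bilinear_lipschitz: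
  assumes prod: "bounded_bilinear p" and S: "compact S"
    and f: "\<exists>L. L-lipschitz_on S f" and g: "\<exists>L. L-lipschitz_on S g"
  shows "\<exists>L. L-lipschitz_on S (\<lambda>x. p (f x) (g x))"
proof -
  interpret bounded_bilinear p by fact
  obtain L M where L: "L-lipschitz_on S f" and M: "M-lipschitz_on S g" using f g by blast
  have "bounded (f ` S)" "bounded (g ` S)"
    using L M S by (auto intro!: compact_imp_bounded compact_continuous_image lipschitz_on_continuous_on)
  then obtain a b where a: "a > 0" "\<And>x. x \<in> S \<Longrightarrow> norm (f x) \<le> a"
    and b: "b > 0" "\<And>x. x \<in> S \<Longrightarrow> norm (g x) \<le> b"
    unfolding bounded_pos by (metis imageI)
  obtain K where K: "K \<ge> 0" "\<And>x y. norm (p x y) \<le> norm x * norm y * K"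
    using nonneg_bounded by blast
  have LM: "L \<ge> 0" "M \<ge> 0" using L M lipschitz_on_nonneg by auto
  have "(L * b * K + a * M * K)-lipschitz_on S (\<lambda>x. p (f x) (g x))"
  proof (rule lipschitz_onI)
    fix x y assume xy: "x \<in> S" "y \<in> S"
    have "dist (p (f x) (g x)) (p (f y) (g y))
        = norm (p (f x - f y) (g x) + p (f y) (g x - g y))"
      by (simp add: dist_norm diff_left diff_right)
    also have "\<dots> \<le> norm (f x - f y) * norm (g x) * K + norm (f y) * norm (g x - g y) * K"
      by (rule norm_triangle_mono[OF K(2) K(2)])
    also have "\<dots> \<le> (L * dist x y) * b * K + a * (M * dist x y) * K"
      using lipschitz_onD[OF L xy] lipschitz_onD[OF M xy] a b K(1) LM xy
      by (intro add_mono mult_right_mono mult_mono) (auto simp: dist_norm)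
    finally show "dist (p (f x) (g x)) (p (f y) (g y)) \<le> (L * b * K + a * M * K) * dist x y"
      by (simp add: algebra_simps)
  qed (use LM a b K in auto)
  then show ?thesis by blast
qed

lemma bounded_bilinear_matrix_vector_mult:
  "bounded_bilinear (\<lambda>(A::real^'n^'m) x. A *v x)"
  unfolding bilinear_conv_bounded_bilinear[symmetric] bilinear_def linear_iff
  by (simp add: matrix_vector_mult_add_rdistrib matrix_vector_right_distrib
      scaleR_matrix_vector_assoc[symmetric] matrix_vector_mult_scaleR)

lemma bounded_bilinear_vector_matrix_mult:
  "bounded_bilinear (\<lambda>(A::real^'n^'m) x. x v* A)"
proof -
  have "x v* (c *\<^sub>R A) = c *\<^sub>R (x v* A)" for c x and A :: "real^'n^'m"
    by (simp add: vector_matrix_mult_def vec_eq_iff sum_distrib_left mult_ac)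
  then show ?thesis
    unfolding bilinear_conv_bounded_bilinear[symmetric] bilinear_def linear_iff
    by (simp add: vector_matrix_mult_add_rdistrib vector_matrix_left_distrib scaleR_vector_matrix_assoc)
qed

text \<open>Gronwall in differential form: \<open>w\<close>, the squared distance damped by
  \<open>exp (- (2 * L * s))\<close>, is nonincreasing. The square avoids the point where the norm
  is not differentiable.\<close>

lemma lipschitz_flow_bound:
  fixes x y :: "real \<Rightarrow> 'a::euclidean_space"
  assumes L: "L-lipschitz_on S F"
    and x: "\<And>t. t \<ge> 0 \<Longrightarrow> (x has_vector_derivative F (x t)) (at t within {0..})"
      "\<And>t. t \<ge> 0 \<Longrightarrow> x t \<in> S"
    and y: "\<And>t. t \<ge> 0 \<Longrightarrow> (y has_vector_derivative F (y t)) (at t within {0..})"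
      "\<And>t. t \<ge> 0 \<Longrightarrow> y t \<in> S"
    and t: "t \<ge> 0"
  shows "norm (x t - y t) \<le> exp (L * t) * norm (x 0 - y 0)"
proof -
  define z where "z s = x s - y s" for s
  define w where "w s = exp (- (2 * L * s)) * (z s \<bullet> z s)" for s
  have dz: "(z has_vector_derivative (F (x s) - F (y s))) (at s within {0..})" if "s \<ge> 0" for s
    unfolding z_def[abs_def] using x(1)[OF that] y(1)[OF that] by (rule has_vector_derivative_diff)
  have "w 0 \<ge> w t"
  proof (rule DERIV_nonpos_imp_decreasing_open[OF t])
    fix s assume s: "0 < s" "s < t"
    let ?d = "F (x s) - F (y s)"
    have "at s within {0..} = at s" using s by (intro at_within_interior) auto
    then have "(z has_vector_derivative ?d) (at s)" using dz[of s] s by simp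
    then have "((\<lambda>s. z s \<bullet> z s) has_vector_derivative (z s \<bullet> ?d + ?d \<bullet> z s)) (at s)"
      by (intro bounded_bilinear.has_vector_derivative[OF bounded_bilinear_inner])
    then have "((\<lambda>s. z s \<bullet> z s) has_real_derivative (z s \<bullet> ?d + ?d \<bullet> z s)) (at s)"
      by (simp add: has_real_derivative_iff_has_vector_derivative)
    then have "(w has_real_derivative
        exp (- (2 * L * s)) * (z s \<bullet> ?d + ?d \<bullet> z s) + exp (- (2 * L * s)) * (- (2 * L)) * (z s \<bullet> z s)) (at s)"
      unfolding w_def[abs_def] by (auto intro!: derivative_eq_intros)
    moreover have "exp (- (2 * L * s)) * (z s \<bullet> ?d + ?d \<bullet> z s) + exp (- (2 * L * s)) * (- (2 * L)) * (z s \<bullet> z s) \<le> 0"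
    proof -
      have "z s \<bullet> ?d \<le> norm (z s) * norm ?d" by (rule norm_cauchy_schwarz)
      also have "\<dots> \<le> norm (z s) * (L * norm (z s))"
        using lipschitz_onD[OF L x(2) y(2), of s s] s
        by (intro mult_left_mono) (auto simp: dist_norm z_def)
      also have "\<dots> = L * (z s \<bullet> z s)" by (simp add: dot_square_norm power2_eq_square)
      finally have "exp (- (2 * L * s)) * (2 * (z s \<bullet> ?d) - 2 * L * (z s \<bullet> z s)) \<le> 0"
        by (intro mult_nonneg_nonpos) auto
      then show ?thesis by (simp add: inner_commute algebra_simps)
    qed
    ultimately show "\<exists>d. (w has_real_derivative d) (at s) \<and> d \<le> 0" by blast
  next
    have "continuous_on {0..t} z"
      by (rule continuous_on_subset[of "{0..}"])
        (simp_all add: continuous_on_eq_continuous_within has_vector_derivative_continuous[OF dz])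
    then show "continuous_on {0..t} w"
      unfolding w_def[abs_def] by (intro continuous_intros)
  qed
  then have "z t \<bullet> z t \<le> exp (2 * L * t) * (z 0 \<bullet> z 0)"
    by (simp add: w_def exp_minus field_simps)
  then have "(norm (z t))\<^sup>2 \<le> (exp (L * t) * norm (z 0))\<^sup>2"
    by (simp add: dot_square_norm power_mult_distrib exp_double[symmetric] mult.assoc)
  then have "norm (z t) \<le> exp (L * t) * norm (z 0)"
    by (rule power2_le_imp_le) simp
  then show ?thesis by (simp add: z_def)
qed

text \<open>As an indefinite integral, \<open>x\<close> is at first only continuous. The feedback
  law then makes the integrand continuous, and the fundamental theorem of calculus applies.\<close>

lemma control_process_feedback_flow:
  assumes p: "control_process f g x0 x u"
    and u: "\<And>s. s \<ge> 0 \<Longrightarrow> u s = U (x s)" and S: "\<And>s. s \<ge> 0 \<Longrightarrow> x s \<in> S"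
    and F: "continuous_on S (\<lambda>y. f y + g y *v U y)"
  shows "x 0 = x0"
    "t \<ge> 0 \<Longrightarrow> (x has_vector_derivative (f (x t) + g (x t) *v U (x t))) (at t within {0..})"
proof -
  let ?h = "\<lambda>s. f (x s) + g (x s) *v u s" and ?F = "\<lambda>y. f y + g y *v U y"
  have int: "?h integrable_on {0..t}" and x: "x t = x0 + integral {0..t} ?h" if "t \<ge> 0" for t
    using p that by (auto simp: control_process_def absolutely_integrable_on_def)
  show "x 0 = x0" using x[of 0] by simp
  assume t: "t \<ge> 0"
  \<comment> \<open>The window extends beyond \<open>t\<close>, so that the derivative within it
    agrees with the one within \<open>{0..}\<close>.\<close>
  let ?I = "{0..t + 1}"
  have "continuous_on ?I (\<lambda>t. x0 + integral {0..t} ?h)"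
    using int t by (intro continuous_intros indefinite_integral_continuous_1) auto
  then have cx: "continuous_on ?I x"
    by (rule continuous_on_eq) (use x in auto)
  have "continuous_on ?I (\<lambda>s. ?F (x s))"
    by (rule continuous_on_compose2[OF F cx]) (use S in auto)
  then have "continuous_on ?I ?h"
    by (rule continuous_on_eq) (use u in auto)
  then have "((\<lambda>t. integral {0..t} ?h) has_vector_derivative ?h t) (at t within ?I)"
    using t by (intro integral_has_vector_derivative) auto
  then have "((\<lambda>t. x0 + integral {0..t} ?h) has_vector_derivative ?h t) (at t within ?I)"
    using has_vector_derivative_add[OF has_vector_derivative_const] by fastforce
  then have "(x has_vector_derivative ?h t) (at t within ?I)"
    by (rule has_vector_derivative_transform[rotated 2]) (use x t in auto)
  moreover have "at t within ?I = at t within {0..}"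
    by (rule at_within_nhd[of _ "{..<t + 1}"]) (use t in auto)
  ultimately show "(x has_vector_derivative ?F (x t)) (at t within {0..})"
    using u[OF t] by simp
qed

text \<open>On a compact set without 0 the running cost has a positive minimum, which is integrated
  over infinite time.\<close>

lemma finite_cost_zero_in_closed:
  assumes r: "continuous_on UNIV r" "\<And>x. r x \<ge> 0" "r -` {0} = {0}" and R: "pos_def_matrix R"
    and cost: "cost r R x u < \<infinity>" and S: "compact S" "\<And>s. s \<ge> 0 \<Longrightarrow> x s \<in> S"
  shows "0 \<in> S"
proof (rule ccontr)
  assume 0: "0 \<notin> S"
  have "S \<noteq> {}" using S(2)[of 0] by auto
  then obtain m where m: "m \<in> S" "\<And>y. y \<in> S \<Longrightarrow> r m \<le> r y"
    using continuous_attains_inf[OF S(1), of r] r(1) continuous_on_subset by blast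
  have "m \<notin> r -` {0}" using r(3) m(1) 0 by auto
  then have "r m \<noteq> 0" by simp
  then have pos: "r m > 0" using r(2)[of m] by simp
  have uR: "u s \<bullet> (R *v u s) \<ge> 0" for s
    using R by (cases "u s = 0") (auto simp: pos_def_matrix_def less_imp_le)
  have "of_nat n \<le> emeasure lebesgue {0::real..}" for n
    using emeasure_mono[of "{0..real n}" "{0..}" lebesgue] by (simp add: ennreal_of_nat_eq_real_of_nat)
  then have inf: "emeasure lebesgue {0::real..} = \<infinity>"
    by (metis ennreal_Ex_less_of_nat infinity_ennreal_def leD top.not_eq_extremum)
  have "(\<integral>\<^sup>+ s. ennreal (r m) \<partial>(lebesgue_on {0::real..})) \<le> cost r R x u"
    unfolding cost_def
  proof (intro nn_integral_mono ennreal_leI)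
    fix s assume "s \<in> space (lebesgue_on {0::real..})"
    then have "r m \<le> r (x s)" by (intro m(2) S(2)) simp
    then show "r m \<le> r (x s) + u s \<bullet> (R *v u s)" using uR[of s] by simp
  qed
  moreover have "(\<integral>\<^sup>+ s. ennreal (r m) \<partial>(lebesgue_on {0::real..})) = \<infinity>"
    using pos inf by (simp add: emeasure_restrict_space ennreal_mult_top)
  ultimately show False using cost by simp
qed

section \<open>The value function at the origin\<close>

lemma value_fn_nonneg: "value_fn f g r R x \<ge> 0"
  by (simp add: value_fn_def)

lemma value_fn_zero:
  assumes f0: "f 0 = 0" and r0: "r 0 = 0"
  shows "value_fn f g r R 0 = 0"
proof -
  have "control_process f g 0 (\<lambda>_. 0) (\<lambda>_. 0)"
    by (simp add: control_process_def f0)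
  moreover have "cost r R (\<lambda>_. 0) (\<lambda>_. 0) = 0" by (simp add: cost_def r0)
  ultimately have "opt_cost f g r R 0 \<le> 0"
    unfolding opt_cost_def by (metis (mono_tags, lifting) INF_lower case_prodI mem_Collect_eq old.prod.case)
  then show ?thesis by (simp add: value_fn_def)
qed

lemma grad_eq_0_at_minimum:
  assumes "v differentiable (at x)" "\<And>y. v x \<le> v y"
  shows "grad v x = 0"
proof -
  have "frechet_derivative v (at x) = (\<lambda>d. 0)"
    by (rule differential_zero_maxmin[OF UNIV_I open_UNIV has_derivative_frechet[OF assms(1)]])
      (use assms(2) in auto)
  then show ?thesis by (simp add: grad_def vec_eq_iff)
qed

text \<open>The covering bound is conditional because the initial \<open>tol + 1\<close> is not a
  distance. After a step, \<open>eps\<close> is the largest distance to the previous data set, and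
  enlarging the set only decreases distances.\<close>

lemma exploration_state_invariant:
  assumes "exploration_state A xs tol D eps"
  shows "(\<exists>B\<subseteq>A. D = {0} \<union> (\<Union>a\<in>B. traj xs a)) \<and> (eps \<le> tol \<longrightarrow> (\<forall>x\<in>A. infdist x D \<le> eps))"
  using assms
proof induction
  case init
  then show ?case by auto
next
  case (step D eps xa)
  then obtain B where B: "B \<subseteq> A" "D = {0} \<union> (\<Union>a\<in>B. traj xs a)" by blast
  have "infdist x (D \<union> traj xs xa) \<le> infdist xa D" if "x \<in> A" for x
  proof -
    have "infdist x (D \<union> traj xs xa) \<le> infdist x D" using B(2) by (intro infdist_mono) auto
    also have "\<dots> \<le> infdist xa D" using step.hyps(4) that by simp
    finally show ?thesis .
  qed
  moreover have "\<exists>B\<subseteq>A. D \<union> traj xs xa = {0} \<union> (\<Union>a\<in>B. traj xs a)"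
    using B step by (intro exI[of _ "insert xa B"]) auto
  ultimately show ?case by blast
qed

text \<open>The infimum need not be attained, so a strict bound is required.\<close>

lemma infdist_less_imp_near:
  assumes "infdist x D < c" "D \<noteq> {}"
  obtains y where "y \<in> D" "dist x y < c"
  using assms cInf_lessD[of "dist x ` D" c] by (auto simp: infdist_notempty)

text \<open>The initial function 0 is itself a Hermite interpolant, for the empty set of
  points.\<close>

lemma vkoga_state_invariant:
  assumes "vkoga_state k v D tol X s"
  shows "X \<subseteq> D \<and> hermite_interpolant k v X s"
  using assms by induction (auto simp: hermite_interpolant_def)

lemma vkoga_output_error:
  assumes "vkoga_output k v D tol s" "tol > 0"
  obtains X where "X \<subseteq> D" "hermite_interpolant k v X s" "\<And>x. x \<in> D \<Longrightarrow> hermite_error v s x \<le> tol"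
proof -
  obtain X where X: "vkoga_state k v D tol X s" "\<And>x. x \<in> D - X \<Longrightarrow> hermite_error v s x \<le> tol"
    using assms(1) by (auto simp: vkoga_output_def)
  have inv: "X \<subseteq> D" "hermite_interpolant k v X s" using vkoga_state_invariant[OF X(1)] by auto
  have "hermite_error v s x \<le> tol" if "x \<in> D" for x
  proof (cases "x \<in> X")
    case True
    then show ?thesis using inv assms(2) by (simp add: hermite_interpolant_def hermite_error_def)
  qed (use X that in auto)
  with inv show ?thesis by (rule that)
qed

lemma norm_le_card_mult:
  fixes x :: "real^'n" and c :: real
  assumes "\<And>i. \<bar>x $ i\<bar> \<le> c"
  shows "norm x \<le> CARD('n) * c"
proof -
  have "norm x \<le> (\<Sum>i\<in>UNIV. \<bar>x $ i\<bar>)" by (rule norm_le_l1_cart)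
  also have "\<dots> \<le> (\<Sum>i\<in>(UNIV :: 'n set). c)" using assms by (rule sum_mono)
  finally show ?thesis by simp
qed

section \<open>The error bound\<close>

text \<open>The constant is \<open>sqrt (4 * M * L)\<close>, with \<open>M\<close> the squared norm
  of \<open>v\<close> in \<open>H\<close> and \<open>L\<close> from the second differences of
  \<open>jet_kernel\<close>; neither involves \<open>X\<close> or \<open>s\<close>. The convex hull
  supplies the segments for the mean value arguments.\<close>

lemma hermite_jet_error_bound:
  fixes k :: "real^'n \<Rightarrow> real^'n \<Rightarrow> real" and \<Omega> :: "(real^'n) set"
  assumes \<Omega>: "compact \<Omega>"
    and k_C4: "C_nbhd 4 (\<lambda>(x, y). k x y) ((convex hull \<Omega>) \<times> (convex hull \<Omega>))"
    and spd: "spd_kernel_on (convex hull \<Omega>) k"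
    and flat: "interior (convex hull \<Omega>) = {} \<longrightarrow>
        (\<exists>U. open U \<and> convex hull \<Omega> \<subseteq> U \<and> spd_kernel_on U k)"
    and rkhs: "is_rkhs k \<Omega> H ip"
    and v: "on_set \<Omega> v \<in> H" "derivative_reproducing k \<Omega> H ip v"
  obtains B where "B \<ge> 0" "\<And>X s x y a. hermite_interpolant k v X s \<Longrightarrow> X \<subseteq> \<Omega> \<Longrightarrow> x \<in> \<Omega> \<Longrightarrow> y \<in> \<Omega> \<Longrightarrow>
    \<bar>(jet v (x, a) - jet s (x, a)) - (jet v (y, a) - jet s (y, a))\<bar> \<le> B * norm (x - y)"
proof -
  interpret rkhs k \<Omega> H ip using rkhs by unfold_locales
  define K where "K = convex hull \<Omega>"
  have K: "compact K" "convex K" "\<Omega> \<subseteq> K"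
    using \<Omega> by (auto simp: K_def compact_convex_hull hull_subset)
  obtain V where V: "open V" "K \<times> K \<subseteq> V" and C4: "C_on 4 (\<lambda>(x, y). k x y) V"
    using k_C4 by (auto simp: C_nbhd_def K_def)
  have C2: "C_on 2 (\<lambda>(x, y). k x y) V" using C4 by (rule C_on_mono[rotated]) simp
  have \<Omega>V: "\<Omega> \<times> \<Omega> \<subseteq> V" using K(3) V(2) by blast
  have "psd_on (K \<times> UNIV) (jet_kernel k)"
    using jet_kernel_psd[OF V(1) C2 V(2) K(1,2)] spd flat by (simp add: K_def)
  then have psd: "psd_on (\<Omega> \<times> UNIV) (jet_kernel k)"
    by (rule psd_on_subset) (use K(3) in auto)
  obtain L where L: "L \<ge> 0" "\<And>x y a. x \<in> K \<Longrightarrow> y \<in> K \<Longrightarrow>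
      jet_kernel k (x, a) (x, a) - jet_kernel k (x, a) (y, a)
        - jet_kernel k (y, a) (x, a) + jet_kernel k (y, a) (y, a) \<le> L * (norm (x - y))\<^sup>2"
    using jet_kernel_difference_bound[OF V(1) C4 K(1,2) V(2)] by blast
  define M where "M = ip (on_set \<Omega> v) (on_set \<Omega> v)"
  have M: "M \<ge> 0" using ip_nonneg[OF v(1)] by (simp add: M_def)
  \<comment> \<open>\<open>\<phi> p\<close> represents the functional \<open>p\<close> on
    \<open>v\<close>: by the reproducing property for values, by
    \<open>derivative_reproducing\<close> for partials.\<close>
  define \<phi> where "\<phi> p = on_set \<Omega> (\<lambda>y. jet (\<lambda>x. k x y) p)" for p
  have \<phi>H: "\<phi> p \<in> H" and \<phi>v: "jet v p = ip (\<phi> p) (on_set \<Omega> v)" if "p \<in> \<Omega> \<times> UNIV" for p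
  proof -
    define x a where "x = fst p" and "a = snd p"
    then have p: "p = (x, a)" "x \<in> \<Omega>" using that by auto
    have "\<phi> p \<in> H \<and> jet v p = ip (\<phi> p) (on_set \<Omega> v)"
    proof (cases a)
      case None
      then have "\<phi> p = on_set \<Omega> (k x)" by (simp add: \<phi>_def p)
      then show ?thesis using kernel_in[OF p(2)] reproducing[OF p(2) v(1)] p None
        by (simp add: on_set_def[of \<Omega> v])
    next
      case (Some i)
      then have "\<phi> p = on_set \<Omega> (\<lambda>y. grad1 k x y $ i)" by (simp add: \<phi>_def p grad1_def)
      then show ?thesis using v(2) p Some by (simp add: derivative_reproducing_def)
    qed
    then show "\<phi> p \<in> H" "jet v p = ip (\<phi> p) (on_set \<Omega> v)" by auto
  qed
  have functional: "(\<Sum>p\<in>J. c p * jet v p)\<^sup>2 \<le> M * (\<Sum>p\<in>J. \<Sum>q\<in>J. c p * c q * jet_kernel k p q)"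
    if J: "finite J" "J \<subseteq> \<Omega> \<times> UNIV" for J c
  proof -
    have "(\<Sum>p\<in>J. c p * jet v p) = (\<Sum>p\<in>J. c p * ip (\<phi> p) (on_set \<Omega> v))"
      using J \<phi>v by (intro sum.cong refl) auto
    moreover have "(\<Sum>p\<in>J. c p * ip (\<phi> p) (on_set \<Omega> v))\<^sup>2
        \<le> M * (\<Sum>p\<in>J. \<Sum>q\<in>J. c p * c q * jet_kernel k p q)"
      unfolding M_def
    proof (rule reproduced_functional_bound[OF psd _ _ _ \<phi>H _ v(1) J])
      show "inj_on (\<lambda>y. (y, None)) \<Omega>" by (simp add: inj_on_def)
      show "k y z = jet_kernel k (y, None) (z, None)" for y z by (simp add: jet_kernel_def)
      show "\<phi> p y = jet_kernel k p (y, None)" if "y \<in> \<Omega>" for p y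
        using that by (simp add: \<phi>_def on_set_def jet_kernel_def)
    qed auto
    ultimately show ?thesis by simp
  qed
  show ?thesis
  proof (rule that[of "sqrt (4 * M * L)"])
    show "sqrt (4 * M * L) \<ge> 0" using M L by simp
    fix X s x y a
    assume s: "hermite_interpolant k v X s" and X: "X \<subseteq> \<Omega>" and xy: "x \<in> \<Omega>" "y \<in> \<Omega>"
    obtain \<sigma> where \<sigma>: "\<And>q. q \<in> \<Omega> \<times> UNIV \<Longrightarrow> jet s q = (\<Sum>p\<in>X \<times> UNIV. \<sigma> p * jet_kernel k p q)"
      "\<And>p. p \<in> X \<times> UNIV \<Longrightarrow> jet s p = jet v p"
      using hermite_interpolant_jet[OF V(1) C2 \<Omega>V s X] by blast
    have Z: "finite (X \<times> (UNIV :: 'n option set))" "X \<times> UNIV \<subseteq> \<Omega> \<times> UNIV"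
      using s X by (auto simp: hermite_interpolant_def)
    have "((jet v (x, a) - jet s (x, a)) - (jet v (y, a) - jet s (y, a)))\<^sup>2 \<le>
        4 * M * (jet_kernel k (x, a) (x, a) - jet_kernel k (x, a) (y, a)
          - jet_kernel k (y, a) (x, a) + jet_kernel k (y, a) (y, a))"
      by (rule interpolation_error_difference_bound[OF psd M functional Z \<sigma>]) (use xy in auto)
    also have "\<dots> \<le> 4 * M * (L * (norm (x - y))\<^sup>2)"
      using M L(2)[of x y a] xy K(3) by (intro mult_left_mono) auto
    also have "\<dots> = (sqrt (4 * M * L) * norm (x - y))\<^sup>2"
      using M L(1) by (simp add: power_mult_distrib)
    finally show "\<bar>(jet v (x, a) - jet s (x, a)) - (jet v (y, a) - jet s (y, a))\<bar>
        \<le> sqrt (4 * M * L) * norm (x - y)"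
      using M L(1) by (intro power2_le_imp_le[of "\<bar>_\<bar>"]) auto
  qed
qed

text \<open>The factor \<open>1 + CARD('n)\<close> counts the value and the partial derivatives, the
  Euclidean norm being bounded by the sum of the components. The second bound, taken with
  \<open>s = 0\<close>, concerns \<open>grad v\<close> alone.\<close>

lemma hermite_error_lipschitz:
  fixes x y :: "real^'n" and B :: real
  assumes B: "\<And>a. \<bar>(jet v (x, a) - jet s (x, a)) - (jet v (y, a) - jet s (y, a))\<bar> \<le> B * norm (x - y)"
  shows "hermite_error v s x \<le> hermite_error v s y + (1 + CARD('n)) * B * norm (x - y)"
    and "norm ((grad v x - grad s x) - (grad v y - grad s y)) \<le> CARD('n) * B * norm (x - y)"
proof -
  let ?d = "(grad v x - grad s x) - (grad v y - grad s y)"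
  have "norm ?d \<le> CARD('n) * (B * norm (x - y))"
    by (rule norm_le_card_mult) (use B[of "Some _"] in simp)
  then show g: "norm ?d \<le> CARD('n) * B * norm (x - y)" by (simp add: mult.assoc)
  have "norm (grad v x - grad s x) \<le> norm (grad v y - grad s y) + norm ?d"
    by (metis add.commute diff_add_cancel norm_triangle_ineq)
  moreover have "\<bar>v x - s x\<bar> \<le> \<bar>v y - s y\<bar> + B * norm (x - y)" using B[of None] by simp
  ultimately show "hermite_error v s x \<le> hermite_error v s y + (1 + CARD('n)) * B * norm (x - y)"
    using g by (simp add: hermite_error_def algebra_simps)
qed

theorem theorem5:
  fixes f :: "real^'n \<Rightarrow> real^'n"
    and g :: "real^'n \<Rightarrow> real^'m^'n"
    and r :: "real^'n \<Rightarrow> real"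
    and R :: "real^'m^'m"
    and v :: "real^'n \<Rightarrow> real"
    and A \<Omega> :: "(real^'n) set"
    and xs :: "real^'n \<Rightarrow> real \<Rightarrow> real^'n"
    and us :: "real^'n \<Rightarrow> real \<Rightarrow> real^'m"
    and k :: "real^'n \<Rightarrow> real^'n \<Rightarrow> real"
    and H :: "(real^'n \<Rightarrow> real) set"
    and ip :: "(real^'n \<Rightarrow> real) \<Rightarrow> (real^'n \<Rightarrow> real) \<Rightarrow> real"
  assumes f0: "f 0 = 0"
    and r: "continuous_on UNIV r" "\<forall>x. r x \<ge> 0" "r -` {0} = {0}"
    and R: "pos_def_matrix R"
    and v_def: "v = value_fn f g r R"
    and A: "A \<noteq> {}" "compact A"
    and optimal: "\<forall>x0\<in>A. optimal_process f g r R x0 (xs x0) (us x0)"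
    and Omega_def: "\<Omega> = traj_closure A xs"
    and v_diff: "\<forall>x\<in>\<Omega>. (\<forall>\<^sub>F y in nhds x. opt_cost f g r R y < \<infinity>) \<and> v differentiable (at x)"
    and feedback: "\<forall>x0\<in>A. \<forall>s\<ge>0. us x0 s =
        - (1/2) *\<^sub>R (matrix_inv R *v (transpose (g (xs x0 s)) *v grad v (xs x0 s)))"
    and Omega_compact: "compact \<Omega>"
    and k_C4: "C_nbhd 4 (\<lambda>(x, y). k x y) ((convex hull \<Omega>) \<times> (convex hull \<Omega>))"
    and k_spd: "spd_kernel_on (convex hull \<Omega>) k"
    and k_spd_flat: "interior (convex hull \<Omega>) = {} \<longrightarrow>
        (\<exists>U. open U \<and> convex hull \<Omega> \<subseteq> U \<and> spd_kernel_on U k)"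
    and radially_unbounded: "(opt_cost f g r R \<longlongrightarrow> \<infinity>) at_infinity"
    and rkhs: "is_rkhs k \<Omega> H ip"
    and v_rkhs: "on_set \<Omega> v \<in> H" "derivative_reproducing k \<Omega> H ip v"
    and fg_C1: "C_nbhd 1 f \<Omega>" "C_nbhd 1 g \<Omega>"
  shows "\<forall>T>0. \<exists>C>0. \<forall>\<epsilon>d>0. \<forall>\<epsilon>f>0. \<forall>D s.
           exploration_output A xs \<epsilon>d D \<and> vkoga_output k v D \<epsilon>f s \<longrightarrow>
           (\<forall>t\<in>{0..T}. \<forall>x0\<in>A.
              \<bar>v (xs x0 t) - s (xs x0 t)\<bar> + norm (grad v (xs x0 t) - grad s (xs x0 t))
                \<le> \<epsilon>d * C + \<epsilon>f)"
proof -
  obtain B where B: "B \<ge> 0" "\<And>X s x y a. hermite_interpolant k v X s \<Longrightarrow> X \<subseteq> \<Omega> \<Longrightarrow>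
      x \<in> \<Omega> \<Longrightarrow> y \<in> \<Omega> \<Longrightarrow>
      \<bar>(jet v (x, a) - jet s (x, a)) - (jet v (y, a) - jet s (y, a))\<bar> \<le> B * norm (x - y)"
    using hermite_jet_error_bound[OF Omega_compact k_C4 k_spd k_spd_flat rkhs v_rkhs] by blast

  \<comment> \<open>Lipschitz continuity of the closed-loop field\<close>
  define U where
    "U y = - (1/2) *\<^sub>R (matrix_inv R *v (transpose (g y) *v grad v y))" for y
  define F where "F y = f y + g y *v U y" for y
  have lip_C1: "\<exists>L. L-lipschitz_on \<Omega> h" if "C_nbhd 1 h \<Omega>"
    for h :: "real^'n \<Rightarrow> 'c::euclidean_space"
    using that C_on_1_lipschitz_on_compact[OF _ _ Omega_compact] unfolding C_nbhd_def by metis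
  have lip_grad: "\<exists>L. L-lipschitz_on \<Omega> (grad v)"
  proof -
    have zero: "hermite_interpolant k v {} (\<lambda>_. 0)" by (simp add: hermite_interpolant_def)
    have "grad (\<lambda>_. 0) x = 0" for x :: "real^'n"
      by (simp add: vec_eq_iff grad_nth_eq[OF has_derivative_const])
    then have "norm (grad v x - grad v y) \<le> CARD('n) * B * norm (x - y)"
      if "x \<in> \<Omega>" "y \<in> \<Omega>" for x y
      using hermite_error_lipschitz(2)[where x=x and y=y and v=v and s="\<lambda>_. 0" and B=B]
        B(2)[OF zero empty_subsetI that] by simp
    then have "(CARD('n) * B)-lipschitz_on \<Omega> (grad v)"
      using B(1) by (intro lipschitz_onI) (auto simp: dist_norm)
    then show ?thesis by blast
  qed
  have const_lip: "\<exists>L. L-lipschitz_on \<Omega> (\<lambda>_. c)" for c :: "'c::metric_space"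
    using lipschitz_on_constant by blast
  have lip_U: "\<exists>L. L-lipschitz_on \<Omega> U"
    unfolding U_def[abs_def] transpose_matrix_vector
    by (intro bounded_bilinear_lipschitz[OF bounded_bilinear_scaleR Omega_compact const_lip]
        bounded_bilinear_lipschitz[OF bounded_bilinear_matrix_vector_mult Omega_compact const_lip]
        bounded_bilinear_lipschitz[OF bounded_bilinear_vector_matrix_mult Omega_compact]
        lip_C1 fg_C1 lip_grad)
  have "\<exists>L. L-lipschitz_on \<Omega> (\<lambda>y. g y *v U y)"
    by (intro bounded_bilinear_lipschitz[OF bounded_bilinear_matrix_vector_mult Omega_compact]
        lip_C1 fg_C1 lip_U)
  then obtain L where L: "L-lipschitz_on \<Omega> F"
    unfolding F_def[abs_def] using lip_C1[OF fg_C1(1)] lipschitz_on_add by blast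
  have L0: "L \<ge> 0" using L by (rule lipschitz_on_nonneg)

  \<comment> \<open>Optimal trajectories as orbits of the field, and its equilibrium\<close>
  have in_\<Omega>: "xs a s \<in> \<Omega>" if "a \<in> A" "s \<ge> 0" for a s
  proof -
    have "xs a s \<in> (\<Union>x0\<in>A. traj xs x0)" using that by (auto simp: traj_def)
    then show ?thesis unfolding Omega_def traj_closure_def by (rule subsetD[OF closure_subset])
  qed
  have flow0: "xs a 0 = a"
    and flow: "s \<ge> 0 \<Longrightarrow> (xs a has_vector_derivative F (xs a s)) (at s within {0..})"
    if "a \<in> A" for a s
  proof -
    have proc: "control_process f g a (xs a) (us a)"
      using optimal that by (simp add: optimal_process_def)
    have u: "us a s = U (xs a s)" if "s \<ge> 0" for s using feedback \<open>a \<in> A\<close> that by (simp add: U_def)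
    have cont: "continuous_on \<Omega> (\<lambda>y. f y + g y *v U y)"
      using lipschitz_on_continuous_on[OF L] by (simp add: F_def[abs_def])
    note flow = control_process_feedback_flow[where U=U, OF proc u in_\<Omega>[OF that] cont]
    show "xs a 0 = a" using flow(1) by simp
    show "s \<ge> 0 \<Longrightarrow> (xs a has_vector_derivative F (xs a s)) (at s within {0..})"
      using flow(2) by (simp add: F_def)
  qed
  have zero_\<Omega>: "0 \<in> \<Omega>"
  proof -
    obtain a where a: "a \<in> A" using A by blast
    have "a \<in> \<Omega>" using in_\<Omega>[OF a, of 0] flow0[OF a] by simp
    \<comment> \<open>\<open>v_diff\<close> includes finiteness of the optimal cost near each point
      of \<open>\<Omega>\<close>, in particular at \<open>a\<close>, the initial point of its own
      trajectory.\<close>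
    then have "opt_cost f g r R a < \<infinity>" using v_diff eventually_nhds_x_imp_x by blast
    then have cost: "cost r R (xs a) (us a) < \<infinity>" using optimal a by (simp add: optimal_process_def)
    show ?thesis
      by (rule finite_cost_zero_in_closed[OF r(1) _ r(3) R cost Omega_compact in_\<Omega>[OF a]])
        (use r in auto)
  qed
  have "grad v 0 = 0"
  proof (rule grad_eq_0_at_minimum)
    show "v differentiable (at 0)" using v_diff zero_\<Omega> by blast
    have "r 0 = 0" using r(3) by blast
    then show "v 0 \<le> v y" for y
      by (simp add: v_def value_fn_zero f0 value_fn_nonneg)
  qed
  then have F0: "F 0 = 0" by (simp add: F_def U_def f0)

  show ?thesis
  proof (intro allI impI)
    fix T :: real assume T: "T > 0"
    define E where "E = (1 + CARD('n)) * B"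
    have E: "E \<ge> 0" using B(1) by (simp add: E_def)
    \<comment> \<open>The 2 is the slack in choosing a data point near \<open>x0\<close>; the
      summand 1 keeps \<open>C\<close> positive when \<open>E = 0\<close>.\<close>
    define C where "C = E * exp (L * T) * 2 + 1"
    have C: "C > 0" using E by (simp add: C_def add_nonneg_pos)
    have "\<bar>v (xs x0 t) - s (xs x0 t)\<bar> + norm (grad v (xs x0 t) - grad s (xs x0 t)) \<le> \<epsilon>d * C + \<epsilon>f"
      if tol: "\<epsilon>d > 0" "\<epsilon>f > 0" and D: "exploration_output A xs \<epsilon>d D"
        and s: "vkoga_output k v D \<epsilon>f s" and t: "t \<in> {0..T}" and x0: "x0 \<in> A"
      for \<epsilon>d \<epsilon>f D s t x0
    proof -
      obtain eps where eps: "exploration_state A xs \<epsilon>d D eps" "eps \<le> \<epsilon>d"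
        using D by (auto simp: exploration_output_def)
      obtain Y where Y: "Y \<subseteq> A" "D = {0} \<union> (\<Union>a\<in>Y. traj xs a)" and near: "infdist x0 D \<le> eps"
        using exploration_state_invariant[OF eps(1)] eps(2) x0 by blast
      have D\<Omega>: "D \<subseteq> \<Omega>" using Y zero_\<Omega> in_\<Omega> by (auto simp: traj_def)
      obtain X where X: "X \<subseteq> D" "hermite_interpolant k v X s"
        "\<And>x. x \<in> D \<Longrightarrow> hermite_error v s x \<le> \<epsilon>f"
        using vkoga_output_error[OF s tol(2)] by blast
      have "infdist x0 D < 2 * \<epsilon>d" using near eps(2) tol(1) by simp
      then obtain y where y: "y \<in> D" "dist x0 y < 2 * \<epsilon>d"
        using infdist_less_imp_near[of x0 D] Y(2) by blast
      \<comment> \<open>The orbit through the data point \<open>y\<close>: constant if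
        \<open>y = 0\<close>, otherwise a time shift of an explored trajectory, which is again an
        orbit because the field is autonomous. It stays in \<open>D\<close>, since trajectories are
        added as a whole.\<close>
      obtain z where z: "z 0 = y" "\<And>s. s \<ge> 0 \<Longrightarrow> z s \<in> D"
        "\<And>s. s \<ge> 0 \<Longrightarrow> (z has_vector_derivative F (z s)) (at s within {0..})"
      proof (cases "y = 0")
        case True
        show ?thesis by (rule that[of "\<lambda>_. 0"]) (use True Y F0 in auto)
      next
        case False
        then obtain a \<tau> where a: "a \<in> Y" "\<tau> \<ge> 0" "y = xs a \<tau>" using y(1) Y by (auto simp: traj_def)
        have aA: "a \<in> A" using a(1) Y(1) by blast
        show ?thesis
        proof (rule that[of "\<lambda>s. xs a (\<tau> + s)"])
          show "xs a (\<tau> + s) \<in> D" if "s \<ge> 0" for s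
          proof -
            have "xs a (\<tau> + s) \<in> traj xs a" using a(2) that by (simp add: traj_def)
            then show ?thesis using a(1) Y(2) by blast
          qed
          show "((\<lambda>s. xs a (\<tau> + s)) has_vector_derivative F (xs a (\<tau> + s))) (at s within {0..})"
            if "s \<ge> 0" for s
          proof -
            have "(xs a has_vector_derivative F (xs a (\<tau> + s))) (at (\<tau> + s) within (\<lambda>s. \<tau> + s) ` {0..})"
              by (rule has_vector_derivative_within_subset[OF flow[OF aA]]) (use a(2) that in auto)
            moreover have "((\<lambda>s. \<tau> + s) has_vector_derivative 1) (at s within {0..})"
              by (auto intro!: derivative_eq_intros)
            ultimately show ?thesis
              using vector_diff_chain_within[of "\<lambda>s. \<tau> + s" 1 s "{0..}" "xs a"] by (simp add: o_def)
          qed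
        qed (use a in simp)
      qed
      have "norm (xs x0 t - z t) \<le> exp (L * t) * norm (xs x0 0 - z 0)"
        by (rule lipschitz_flow_bound[OF L flow[OF x0] in_\<Omega>[OF x0] z(3)]) (use z D\<Omega> t in auto)
      also have "\<dots> \<le> exp (L * T) * (2 * \<epsilon>d)"
        using y(2) t L0 by (intro mult_mono) (auto simp: flow0[OF x0] z(1) dist_norm mult_left_mono)
      finally have dist: "norm (xs x0 t - z t) \<le> exp (L * T) * (2 * \<epsilon>d)" .
      have zt: "z t \<in> D" using z(2) t by simp
      have "hermite_error v s (xs x0 t) \<le> hermite_error v s (z t) + E * norm (xs x0 t - z t)"
        unfolding E_def
        by (rule hermite_error_lipschitz(1), rule B(2)[OF X(2)]) (use X(1) D\<Omega> in_\<Omega>[OF x0] t zt in auto)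
      also have "\<dots> \<le> \<epsilon>f + E * (exp (L * T) * (2 * \<epsilon>d))"
        using X(3)[OF zt] dist E by (intro add_mono mult_left_mono)
      also have "\<dots> \<le> \<epsilon>d * C + \<epsilon>f" using tol(1) by (simp add: C_def algebra_simps)
      finally show ?thesis by (simp add: hermite_error_def)
    qed
    with C show "\<exists>C>0. \<forall>\<epsilon>d>0. \<forall>\<epsilon>f>0. \<forall>D s.
           exploration_output A xs \<epsilon>d D \<and> vkoga_output k v D \<epsilon>f s \<longrightarrow>
           (\<forall>t\<in>{0..T}. \<forall>x0\<in>A.
              \<bar>v (xs x0 t) - s (xs x0 t)\<bar> + norm (grad v (xs x0 t) - grad s (xs x0 t))
                \<le> \<epsilon>d * C + \<epsilon>f)"
      by blast
  qed
qed

end
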